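(* Let $(b,0)$ be a graph over the discrete measure space $(X,m)$ and let $L_0$ be a realization associated with a form $(Q_0,D(Q_0))$ over $(b,0)$ such that $D(Q_0)$, equipped with the form norm $\|\cdot\|_{Q_0}$, is compactly embedded in $\ell^2(X,m)$. Let $c\colon X\to[0,\infty)$ and let $L_c$ be the corresponding induced realization. Let $\lambda_n(0)$ and $\lambda_n(c)$ denote the $n$-th eigenvalues of $L_0$ and $L_c$, respectively. Then $$\sum_{n=1}^{\dim \ell^2(X,m)} \big(\lambda_n(c)-\lambda_n(0)\big)=\sum_{x\in X}\frac{c(x)}{m(x)},$$ where the right-hand side equals $+\infty$ if the map $X\ni x\mapsto \frac{c(x)}{m(x)}$ does not belong to $\ell^1(X,\mathbf 1)$ (in which case the left-hand side is $+\infty$ as well). Both sums in this formula are finite sums (have finitely many terms) if and only if $X$ is finite.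
   Context: Let $X$ be a non-empty, at most countable set, $b\colon X\times X\to[0,\infty)$ symmetric with $b(x,x)=0$ and $\sum_{y\in X}b(x,y)<\infty$ for all $x\in X$, and let $c\colon X\to[0,\infty)$ and $m\colon X\to(0,\infty)$ be maps; $m$ is extended to a measure on $X$ by $m(A)=\sum_{x\in A}m(x)$. Then $(b,c)$ is called a graph over the discrete measure space $(X,m)$. Let $C(X)$ be the space of real functions on $X$, $C_c(X)$ the subspace of finitely supported functions, and let $\ell^2(X,m)=\{f\in C(X):\sum_{x\in X}|f(x)|^2m(x)<\infty\}$ be the Hilbert space with scalar product $\langle f,g\rangle=\sum_{x\in X}f(x)g(x)m(x)$. $\ell^1(X,\mathbf 1)$ denotes absolutely summable functions with respect to counting measure. Set $\mathcal D_{b,c}=\{f\in C(X):\sum_{x,y\in X}b(x,y)|f(x)-f(y)|^2+\sum_{x\in X}c(x)|f(x)|^2<\infty\}$ and, for $f,g\in\mathcal D_{b,c}$, $$\mathcal Q_{b,c}(f,g)=\tfrac12\sum_{x,y\in X}b(x,y)(f(x)-f(y))(g(x)-g(y))+\sum_{x\in X}c(x)f(x)g(x).$$ Realization: let $Q_0$ be the restriction of $\mathcal Q_{b,0}$ to a linear subspace $D(Q_0)\subset \ell^2(X,m)\cap\mathcal D_{b,0}$ with $C_c(X)\subset D(Q_0)$ such that $Q_0$ is closed, i.e. $D(Q_0)$ is complete with respect to the form norm $\|f\|_{Q_0}^2=\|f\|_{\ell^2(X,m)}^2+Q_0(f,f)$. The positive self-adjoint operator $L_0$ in $\ell^2(X,m)$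 associated with $Q_0$ via the form representation theorem ($D(L_0)\subset D(Q_0)$ and $Q_0(f,g)=\langle f,L_0g\rangle$ for $f\in D(Q_0)$, $g\in D(L_0)$) is called a realization. Induced realization: given a realization $L_0$ and $c\colon X\to[0,\infty)$, let $Q_c$ be the restriction of $\mathcal Q_{b,c}$ to $$D(Q_c)=D(Q_0)\cap\Big\{f\in\ell^2(X,m):\sum_{x\in X}c(x)|f(x)|^2<\infty\Big\}.$$ The self-adjoint operator $L_c$ in $\ell^2(X,m)$ associated with $Q_c$ is called the induced realization of $c$. Under the compact embedding hypothesis on $D(Q_0)$, both $L_0$ and $L_c$ have purely discrete spectrum; their eigenvalues $\lambda_n(0)$, $\lambda_n(c)$, $n=1,\dots,\dim\ell^2(X,m)$, are listed in non-decreasing order, counted with multiplicity. If $X$ is infinite, $\dim\ell^2(X,m)=\infty$ and $n$ ranges over all positive integers. *)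

theory Defs
  imports "HOL-Analysis.Analysis" "HOL-Library.Function_Algebras" "HOL-Library.Extended_Nat"
begin

text \<open>
  The set \<open>X\<close> is the universe of a type \<open>'a\<close> of class \<open>countable\<close>: non-empty, and finite
  or countably infinite. Functions on \<open>X\<close> are HOL functions, with the real vector space
  structure below; all sums are unordered.
\<close>

interpretation fun_space: vector_space "\<lambda>(r::real) (f :: 'a \<Rightarrow> real) x. r * f x"
  by unfold_locales (auto simp: fun_eq_iff algebra_simps)

definition ecard :: "'b set \<Rightarrow> enat" where
  "ecard S = (if finite S then enat (card S) else \<infinity>)"

text \<open>The library dimension \<^const>\<open>vector_space.dim\<close> is \<open>nat\<close>-valued, and its value for spaces
  without a finite basis carries no information; here those spaces get the dimension \<open>\<infinity>\<close>.\<close>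

definition edim :: "('a \<Rightarrow> real) set \<Rightarrow> enat" where
  "edim V = (if \<exists>B. finite B \<and> V \<subseteq> fun_space.span B then enat (fun_space.dim V) else \<infinity>)"


subsection \<open>Graphs over discrete measure spaces and their quadratic forms\<close>

definition weighted_graph :: "('a \<Rightarrow> 'a \<Rightarrow> real) \<Rightarrow> ('a \<Rightarrow> real) \<Rightarrow> bool" where
  "weighted_graph b c \<longleftrightarrow>
     (\<forall>x y. b x y \<ge> 0) \<and> (\<forall>x y. b x y = b y x) \<and> (\<forall>x. b x x = 0) \<and>
     (\<forall>x. (\<lambda>y. b x y) summable_on UNIV) \<and> (\<forall>x. c x \<ge> 0)"

definition finitely_supported :: "('a \<Rightarrow> real) set" where
  "finitely_supported = {f. finite {x. f x \<noteq> 0}}"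

definition ell2 :: "('a \<Rightarrow> real) \<Rightarrow> ('a \<Rightarrow> real) set" where
  "ell2 m = {f. (\<lambda>x. \<bar>f x\<bar>^2 * m x) summable_on UNIV}"

definition ell2_inner :: "('a \<Rightarrow> real) \<Rightarrow> ('a \<Rightarrow> real) \<Rightarrow> ('a \<Rightarrow> real) \<Rightarrow> real" where
  "ell2_inner m f g = (\<Sum>\<^sub>\<infinity>x. f x * g x * m x)"

definition ell2_norm :: "('a \<Rightarrow> real) \<Rightarrow> ('a \<Rightarrow> real) \<Rightarrow> real" where
  "ell2_norm m f = sqrt (ell2_inner m f f)"

definition finite_energy :: "('a \<Rightarrow> 'a \<Rightarrow> real) \<Rightarrow> ('a \<Rightarrow> real) \<Rightarrow> ('a \<Rightarrow> real) set" where
  "finite_energy b c =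
     {f. (\<lambda>(x, y). b x y * \<bar>f x - f y\<bar>^2) summable_on UNIV \<and>
         (\<lambda>x. c x * \<bar>f x\<bar>^2) summable_on UNIV}"

definition energy_form ::
  "('a \<Rightarrow> 'a \<Rightarrow> real) \<Rightarrow> ('a \<Rightarrow> real) \<Rightarrow> ('a \<Rightarrow> real) \<Rightarrow> ('a \<Rightarrow> real) \<Rightarrow> real" where
  "energy_form b c f g =
     1/2 * (\<Sum>\<^sub>\<infinity>(x, y). b x y * (f x - f y) * (g x - g y)) + (\<Sum>\<^sub>\<infinity>x. c x * f x * g x)"

definition form_norm ::
  "('a \<Rightarrow> real) \<Rightarrow> (('a \<Rightarrow> real) \<Rightarrow> ('a \<Rightarrow> real) \<Rightarrow> real) \<Rightarrow> ('a \<Rightarrow> real) \<Rightarrow> real" where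
  "form_norm m Q f = sqrt ((ell2_norm m f)^2 + Q f f)"

definition complete_wrt :: "(('a \<Rightarrow> real) \<Rightarrow> real) \<Rightarrow> ('a \<Rightarrow> real) set \<Rightarrow> bool" where
  "complete_wrt N D \<longleftrightarrow>
     (\<forall>u :: nat \<Rightarrow> 'a \<Rightarrow> real.
        (\<forall>n. u n \<in> D) \<and> (\<forall>e>0. \<exists>M. \<forall>i\<ge>M. \<forall>j\<ge>M. N (u i - u j) < e) \<longrightarrow>
        (\<exists>f\<in>D. (\<lambda>n. N (u n - f)) \<longlonglongrightarrow> 0))"

definition compactly_embedded ::
  "('a \<Rightarrow> real) \<Rightarrow> (('a \<Rightarrow> real) \<Rightarrow> ('a \<Rightarrow> real) \<Rightarrow> real) \<Rightarrow> ('a \<Rightarrow> real) set \<Rightarrow> bool" where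
  "compactly_embedded m Q D \<longleftrightarrow>
     (\<forall>u :: nat \<Rightarrow> 'a \<Rightarrow> real.
        (\<forall>n. u n \<in> D) \<and> (\<exists>K. \<forall>n. form_norm m Q (u n) \<le> K) \<longrightarrow>
        (\<exists>r f. strict_mono r \<and> f \<in> ell2 m \<and> (\<lambda>n. ell2_norm m (u (r n) - f)) \<longlonglongrightarrow> 0))"


subsection \<open>Operators and realizations\<close>

text \<open>An operator in \<open>ell2 m\<close> is given by its domain \<open>D\<close> and a map \<open>L\<close>, of which only the
  values on \<open>D\<close> matter.\<close>

definition densely_defined_operator ::
  "('a \<Rightarrow> real) \<Rightarrow> ('a \<Rightarrow> real) set \<Rightarrow> (('a \<Rightarrow> real) \<Rightarrow> ('a \<Rightarrow> real)) \<Rightarrow> bool" where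
  "densely_defined_operator m D L \<longleftrightarrow>
     fun_space.subspace D \<and> D \<subseteq> ell2 m \<and> L ` D \<subseteq> ell2 m \<and>
     (\<forall>f\<in>D. \<forall>g\<in>D. L (f + g) = L f + L g) \<and>
     (\<forall>r. \<forall>f\<in>D. L (\<lambda>x. r * f x) = (\<lambda>x. r * L f x)) \<and>
     (\<forall>f\<in>ell2 m. \<forall>e>0. \<exists>g\<in>D. ell2_norm m (f - g) < e)"

definition operator_graph ::
  "('a \<Rightarrow> real) set \<Rightarrow> (('a \<Rightarrow> real) \<Rightarrow> ('a \<Rightarrow> real)) \<Rightarrow> (('a \<Rightarrow> real) \<times> ('a \<Rightarrow> real)) set" where
  "operator_graph D L = {(f, L f) | f. f \<in> D}"

definition adjoint_graph ::
  "('a \<Rightarrow> real) \<Rightarrow> ('a \<Rightarrow> real) set \<Rightarrow> (('a \<Rightarrow> real) \<Rightarrow> ('a \<Rightarrow> real)) \<Rightarrow>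
     (('a \<Rightarrow> real) \<times> ('a \<Rightarrow> real)) set" where
  "adjoint_graph m D L =
     {(g, h). g \<in> ell2 m \<and> h \<in> ell2 m \<and> (\<forall>f\<in>D. ell2_inner m (L f) g = ell2_inner m f h)}"

definition self_adjoint_operator ::
  "('a \<Rightarrow> real) \<Rightarrow> ('a \<Rightarrow> real) set \<Rightarrow> (('a \<Rightarrow> real) \<Rightarrow> ('a \<Rightarrow> real)) \<Rightarrow> bool" where
  "self_adjoint_operator m D L \<longleftrightarrow>
     densely_defined_operator m D L \<and> operator_graph D L = adjoint_graph m D L"

text \<open>\<open>(D, L)\<close> is the operator associated with the form \<open>Q\<close> on \<open>DQ\<close> by the form
  representation theorem.\<close>

definition associated_operator ::
  "('a \<Rightarrow> real) \<Rightarrow> (('a \<Rightarrow> real) \<Rightarrow> ('a \<Rightarrow> real) \<Rightarrow> real) \<Rightarrow> ('a \<Rightarrow> real) set \<Rightarrow>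
     ('a \<Rightarrow> real) set \<Rightarrow> (('a \<Rightarrow> real) \<Rightarrow> ('a \<Rightarrow> real)) \<Rightarrow> bool" where
  "associated_operator m Q DQ D L \<longleftrightarrow>
     self_adjoint_operator m D L \<and> (\<forall>f\<in>D. ell2_inner m f (L f) \<ge> 0) \<and>
     D \<subseteq> DQ \<and> (\<forall>f\<in>DQ. \<forall>g\<in>D. Q f g = ell2_inner m f (L g))"

definition realization_form ::
  "('a \<Rightarrow> real) \<Rightarrow> ('a \<Rightarrow> 'a \<Rightarrow> real) \<Rightarrow> ('a \<Rightarrow> real) set \<Rightarrow> bool" where
  "realization_form m b DQ \<longleftrightarrow>
     fun_space.subspace DQ \<and> DQ \<subseteq> ell2 m \<inter> finite_energy b (\<lambda>_. 0) \<and>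
     finitely_supported \<subseteq> DQ \<and> complete_wrt (form_norm m (energy_form b (\<lambda>_. 0))) DQ"

definition realization ::
  "('a \<Rightarrow> real) \<Rightarrow> ('a \<Rightarrow> 'a \<Rightarrow> real) \<Rightarrow> ('a \<Rightarrow> real) set \<Rightarrow>
     ('a \<Rightarrow> real) set \<Rightarrow> (('a \<Rightarrow> real) \<Rightarrow> ('a \<Rightarrow> real)) \<Rightarrow> bool" where
  "realization m b DQ D L \<longleftrightarrow>
     realization_form m b DQ \<and> associated_operator m (energy_form b (\<lambda>_. 0)) DQ D L"

definition induced_form_domain ::
  "('a \<Rightarrow> real) \<Rightarrow> ('a \<Rightarrow> real) \<Rightarrow> ('a \<Rightarrow> real) set \<Rightarrow> ('a \<Rightarrow> real) set" where
  "induced_form_domain m c DQ = DQ \<inter> {f \<in> ell2 m. (\<lambda>x. c x * \<bar>f x\<bar>^2) summable_on UNIV}"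

definition induced_realization ::
  "('a \<Rightarrow> real) \<Rightarrow> ('a \<Rightarrow> 'a \<Rightarrow> real) \<Rightarrow> ('a \<Rightarrow> real) \<Rightarrow> ('a \<Rightarrow> real) set \<Rightarrow>
     ('a \<Rightarrow> real) set \<Rightarrow> (('a \<Rightarrow> real) \<Rightarrow> ('a \<Rightarrow> real)) \<Rightarrow> bool" where
  "induced_realization m b c DQ D L \<longleftrightarrow>
     associated_operator m (energy_form b c) (induced_form_domain m c DQ) D L"


subsection \<open>Eigenvalues\<close>

definition eigenspace ::
  "('a \<Rightarrow> real) set \<Rightarrow> (('a \<Rightarrow> real) \<Rightarrow> ('a \<Rightarrow> real)) \<Rightarrow> real \<Rightarrow> ('a \<Rightarrow> real) set" where
  "eigenspace D L t = {f \<in> D. L f = (\<lambda>x. t * f x)}"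

definition eigenvalue_indices :: "('a \<Rightarrow> real) \<Rightarrow> nat set" where
  "eigenvalue_indices m = {n. 1 \<le> n \<and> enat n \<le> edim (ell2 m)}"

definition eigenvalue_listing ::
  "('a \<Rightarrow> real) \<Rightarrow> ('a \<Rightarrow> real) set \<Rightarrow> (('a \<Rightarrow> real) \<Rightarrow> ('a \<Rightarrow> real)) \<Rightarrow> (nat \<Rightarrow> real) \<Rightarrow> bool" where
  "eigenvalue_listing m D L lam \<longleftrightarrow>
     mono_on (eigenvalue_indices m) lam \<and>
     (\<forall>t. ecard {n \<in> eigenvalue_indices m. lam n = t} = edim (eigenspace D L t))"

text \<open>The \<open>n\<close>-th eigenvalue: for a positive operator with purely discrete spectrum a listing
  exists, and its values on \<^const>\<open>eigenvalue_indices\<close> are unique. For other operators and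
  other indices the value is unspecified.\<close>

definition eigenvalue ::
  "('a \<Rightarrow> real) \<Rightarrow> ('a \<Rightarrow> real) set \<Rightarrow> (('a \<Rightarrow> real) \<Rightarrow> ('a \<Rightarrow> real)) \<Rightarrow> nat \<Rightarrow> real" where
  "eigenvalue m D L = (SOME lam. eigenvalue_listing m D L lam)"

text \<open>The sum of a family of non-negative reals, read as \<open>\<infinity>\<close> if the family is not in
  \<open>\<ell>\<^sup>1\<close>.\<close>

definition ell1_sum_or_infinity :: "('a \<Rightarrow> real) \<Rightarrow> ereal" where
  "ell1_sum_or_infinity f =
     (if (\<lambda>x. \<bar>f x\<bar>) summable_on UNIV then ereal (\<Sum>\<^sub>\<infinity>x. f x) else \<infinity>)"

end

theory Submission
  imports Defs
begin

text \<open>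
  Let \<open>e\<^sub>n\<close> and \<open>f\<^sub>n\<close> be orthonormal eigenbases of \<open>L\<^sub>0\<close> and \<open>L\<^sub>c\<close>. Ky Fan's trace inequality says
  that the sum of the lowest \<open>N\<close> eigenvalues is at most the sum of the values of the form on any
  \<open>N\<close> orthonormal vectors of the form domain. Applied to \<open>Q\<^sub>0\<close> and the \<open>f\<^sub>n\<close>, and to \<open>Q\<^sub>c\<close> and the \<open>e\<^sub>n\<close>,
  it bounds the \<open>N\<close>-th partial sum of \<open>\<lambda>\<^sub>n(c) - \<lambda>\<^sub>n(0)\<close> from below by \<open>\<Sum>\<^sub>n\<^sub><\<^sub>N \<Sum>\<^sub>x c(x) f\<^sub>n(x)\<^sup>2\<close> and from above
  by \<open>\<Sum>\<^sub>n\<^sub><\<^sub>N \<Sum>\<^sub>x c(x) e\<^sub>n(x)\<^sup>2\<close>. By Parseval's identity for normalized point masses,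
  \<open>\<Sum>\<^sub>n f\<^sub>n(x)\<^sup>2 = \<Sum>\<^sub>n e\<^sub>n(x)\<^sup>2 = 1 / m(x)\<close>, so both bounds tend to \<open>\<Sum>\<^sub>x c(x) / m(x)\<close>; if this is finite, the
  \<open>e\<^sub>n\<close> lie in the domain of \<open>Q\<^sub>c\<close>. The eigenbases are constructed by successive
  minimization of the forms, without the spectral theorem.
\<close>

section \<open>Positive semidefinite forms\<close>

text \<open>The forms of interest are infinite sums, which are well behaved only on functions of
  finite energy; hence all laws are restricted to \<open>D\<close>. Semidefiniteness instead of
  definiteness admits the shifted form \<open>Q - Q v v * H\<close> of the Euler-Lagrange
  argument.\<close>

locale psd_form = vector_space scale
  for scale :: "real \<Rightarrow> 'v::ab_group_add \<Rightarrow> 'v" (infixr "\<cdot>" 75) +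
  fixes D :: "'v set" and B :: "'v \<Rightarrow> 'v \<Rightarrow> real"
  assumes D_subspace: "subspace D"
    and sym: "x \<in> D \<Longrightarrow> y \<in> D \<Longrightarrow> B x y = B y x"
    and add_left: "x \<in> D \<Longrightarrow> y \<in> D \<Longrightarrow> z \<in> D \<Longrightarrow> B (x + y) z = B x z + B y z"
    and scale_left: "x \<in> D \<Longrightarrow> y \<in> D \<Longrightarrow> B (r \<cdot> x) y = r * B x y"
    and nonneg: "x \<in> D \<Longrightarrow> 0 \<le> B x x"
begin

lemma D_closed:
  "0 \<in> D" "x \<in> D \<Longrightarrow> y \<in> D \<Longrightarrow> x + y \<in> D" "x \<in> D \<Longrightarrow> y \<in> D \<Longrightarrow> x - y \<in> D"
  "x \<in> D \<Longrightarrow> r \<cdot> x \<in> D" "(\<And>i. i \<in> I \<Longrightarrow> f i \<in> D) \<Longrightarrow> sum f I \<in> D"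
  using D_subspace by (auto intro: subspace_0 subspace_add subspace_diff subspace_scale subspace_sum)

lemma add_right: "x \<in> D \<Longrightarrow> y \<in> D \<Longrightarrow> z \<in> D \<Longrightarrow> B z (x + y) = B z x + B z y"
  by (metis add_left sym D_closed(2))

lemma scale_right: "x \<in> D \<Longrightarrow> y \<in> D \<Longrightarrow> B x (r \<cdot> y) = r * B x y"
  by (metis scale_left sym D_closed(4))

lemma diff_left: "x \<in> D \<Longrightarrow> y \<in> D \<Longrightarrow> z \<in> D \<Longrightarrow> B (x - y) z = B x z - B y z"
  by (metis add_left D_closed(3) add_diff_cancel diff_add_cancel)

lemma diff_right: "x \<in> D \<Longrightarrow> y \<in> D \<Longrightarrow> z \<in> D \<Longrightarrow> B z (x - y) = B z x - B z y"
  by (metis diff_left sym D_closed(3))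

lemma zero_left: "x \<in> D \<Longrightarrow> B 0 x = 0"
  using diff_left[of x x x] by simp

lemma zero_right: "x \<in> D \<Longrightarrow> B x 0 = 0"
  using diff_right[of x x x] by simp

lemma sum_left:
  "(\<And>i. i \<in> I \<Longrightarrow> f i \<in> D) \<Longrightarrow> y \<in> D \<Longrightarrow> B (sum f I) y = (\<Sum>i\<in>I. B (f i) y)"
  by (induction I rule: infinite_finite_induct) (auto simp: zero_left add_left D_closed)

lemma sum_right:
  "(\<And>i. i \<in> I \<Longrightarrow> f i \<in> D) \<Longrightarrow> y \<in> D \<Longrightarrow> B y (sum f I) = (\<Sum>i\<in>I. B y (f i))"
  by (induction I rule: infinite_finite_induct) (auto simp: zero_right add_right D_closed)

lemma square_add:
  "x \<in> D \<Longrightarrow> y \<in> D \<Longrightarrow> B (x + y) (x + y) = B x x + 2 * B x y + B y y"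
  by (simp add: add_left add_right D_closed sym[of y x])

lemma square_diff:
  "x \<in> D \<Longrightarrow> y \<in> D \<Longrightarrow> B (x - y) (x - y) = B x x - 2 * B x y + B y y"
  by (simp add: diff_left diff_right D_closed sym[of y x])

lemma square_scale: "x \<in> D \<Longrightarrow> B (r \<cdot> x) (r \<cdot> x) = r\<^sup>2 * B x x"
  by (simp add: scale_left scale_right D_closed power2_eq_square)

lemma parallelogram:
  "x \<in> D \<Longrightarrow> y \<in> D \<Longrightarrow> B (x - y) (x - y) + B (x + y) (x + y) = 2 * B x x + 2 * B y y"
  by (simp add: square_diff square_add)

text \<open>The polynomial \<open>B x x + 2 * t * B x y + t\<^sup>2 * B y y\<close> is non-negative
  in \<open>t\<close>. If \<open>B y y = 0\<close> it is affine, so its slope vanishes; otherwise it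
  is evaluated at its minimum \<open>- B x y / B y y\<close>.\<close>

lemma cauchy_schwarz:
  assumes "x \<in> D" "y \<in> D"
  shows "(B x y)\<^sup>2 \<le> B x x * B y y"
proof -
  have q: "0 \<le> B x x + 2 * t * B x y + t\<^sup>2 * B y y" for t
    using nonneg[of "x + t \<cdot> y"] assms
    by (simp add: square_add scale_left scale_right D_closed power2_eq_square mult.assoc)
  show ?thesis
  proof (cases "B y y = 0")
    case True
    have "B x y = 0"
    proof (rule ccontr)
      assume "B x y \<noteq> 0"
      \<comment> \<open>At this \<open>t\<close> the affine function takes the value
        \<open>-1\<close>.\<close>
      then show False using q[of "- (B x x + 1) / (2 * B x y)"] True by (simp add: field_simps)
    qed
    then show ?thesis using True by simp
  next
    case False
    then have pos: "B y y > 0" using nonneg[OF assms(2)] by simp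
    have "0 \<le> (B x x + 2 * (- B x y / B y y) * B x y + (- B x y / B y y)\<^sup>2 * B y y) * B y y"
      using q[of "- B x y / B y y"] pos by (intro mult_nonneg_nonneg) auto
    also have "\<dots> = B x x * B y y - (B x y)\<^sup>2"
      using pos by (simp add: field_simps power2_eq_square)
    finally show ?thesis by simp
  qed
qed

lemma tendsto_left:
  assumes u: "\<And>n. u n \<in> D" and f: "f \<in> D" and y: "y \<in> D"
    and lim: "(\<lambda>n. B (u n - f) (u n - f)) \<longlonglongrightarrow> 0"
  shows "(\<lambda>n. B (u n) y) \<longlonglongrightarrow> B f y"
proof -
  have "(\<lambda>n. B (u n - f) (u n - f) * B y y) \<longlonglongrightarrow> 0"
    using tendsto_mult_right[OF lim, of "B y y"] by simp
  then have "(\<lambda>n. (B (u n - f) y)\<^sup>2) \<longlonglongrightarrow> 0"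
    by (rule tendsto_sandwich[OF _ _ tendsto_const, rotated -1])
       (auto intro!: always_eventually cauchy_schwarz u f y D_closed)
  then have "(\<lambda>n. B (u n - f) y) \<longlonglongrightarrow> 0"
    by simp
  then show ?thesis
    using u f y by (simp add: diff_left LIM_zero_iff)
qed

lemma tendsto_square:
  assumes u: "\<And>n. u n \<in> D" and f: "f \<in> D"
    and lim: "(\<lambda>n. B (u n - f) (u n - f)) \<longlonglongrightarrow> 0"
  shows "(\<lambda>n. B (u n) (u n)) \<longlonglongrightarrow> B f f"
proof -
  have "(\<lambda>n. B (u n - f) (u n - f) + 2 * B (u n) f - B f f) \<longlonglongrightarrow> 0 + 2 * B f f - B f f"
    by (intro tendsto_intros lim tendsto_left u f)
  then show ?thesis
    using u f by (simp add: square_diff)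
qed

end

text \<open>Gaussian elimination, by induction on the number of equations. It later supplies the
  test vector of the Courant-Fischer argument.\<close>

lemma homogeneous_system_nontrivial:
  fixes M :: "nat \<Rightarrow> 'i \<Rightarrow> real"
  assumes "finite I" "n < card I"
  shows "\<exists>a. (\<exists>i\<in>I. a i \<noteq> 0) \<and> (\<forall>j<n. (\<Sum>i\<in>I. a i * M j i) = 0)"
  using assms
proof (induction n arbitrary: I M)
  case 0
  then obtain i where "i \<in> I" by fastforce
  then show ?case by (intro exI[of _ "\<lambda>_. 1"]) auto
next
  case (Suc n)
  show ?case
  proof (cases "\<forall>i\<in>I. M n i = 0")
    case True
    with Suc.IH[OF Suc.prems(1)] Suc.prems(2) obtain a
      where "\<exists>i\<in>I. a i \<noteq> 0" "\<forall>j<n. (\<Sum>i\<in>I. a i * M j i) = 0" by (meson Suc_lessD)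
    then show ?thesis using True by (intro exI[of _ a]) (auto simp: less_Suc_eq)
  next
    case False
    then obtain k where k: "k \<in> I" "M n k \<noteq> 0" by blast
    let ?I = "I - {k}"
    \<comment> \<open>The unknown with index \<open>k\<close> is eliminated by means of equation
      \<open>n\<close>.\<close>
    let ?M = "\<lambda>j i. M j i - M n i / M n k * M j k"
    have "n < card ?I" using Suc.prems k by simp
    from Suc.IH[OF _ this, of ?M] Suc.prems obtain a
      where a: "\<exists>i\<in>?I. a i \<noteq> 0" "\<And>j. j < n \<Longrightarrow> (\<Sum>i\<in>?I. a i * ?M j i) = 0" by blast
    \<comment> \<open>The value at \<open>k\<close> is read off from equation \<open>n\<close>; in
      the other equations its contribution is exactly the correction built into
      \<open>?M\<close>.\<close>
    define a' where "a' = a(k := - (\<Sum>i\<in>?I. a i * M n i) / M n k)"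
    have a'_sum: "(\<Sum>i\<in>I. a' i * M j i) = a' k * M j k + (\<Sum>i\<in>?I. a i * M j i)" for j
    proof -
      have "(\<Sum>i\<in>?I. a' i * M j i) = (\<Sum>i\<in>?I. a i * M j i)"
        by (intro sum.cong) (auto simp: a'_def)
      then show ?thesis using sum.remove[OF Suc.prems(1) k(1), of "\<lambda>i. a' i * M j i"] by simp
    qed
    have "(\<Sum>i\<in>I. a' i * M j i) = 0" if "j < Suc n" for j
    proof (cases "j = n")
      case True
      then show ?thesis using k unfolding a'_sum by (simp add: a'_def)
    next
      case False
      with that a(2)[of j] have "(\<Sum>i\<in>?I. a i * ?M j i) = 0" by simp
      moreover have "(\<Sum>i\<in>?I. a i * ?M j i) =
          (\<Sum>i\<in>?I. a i * M j i) - (\<Sum>i\<in>?I. a i * M n i) / M n k * M j k"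
        by (simp add: right_diff_distrib sum_subtractf sum_divide_distrib sum_distrib_right mult.assoc)
      ultimately show ?thesis unfolding a'_sum by (simp add: a'_def)
    qed
    then show ?thesis using a(1) by (intro exI[of _ a']) (auto simp: a'_def)
  qed
qed

section \<open>Eigenvectors by successive minimization\<close>

text \<open>\<open>H\<close> stands for the Hilbert space scalar product and \<open>Q\<close> for
  the closed form on its domain \<open>D\<close>. The assumption \<open>complete\<close> expresses
  closedness. Compact embedding is phrased as the existence of an \<open>H\<close>-Cauchy
  subsequence, so that no ambient space containing the limits has to be mentioned.\<close>

locale discrete_form = H: psd_form scale D H + Q: psd_form scale D Q
  for scale :: "real \<Rightarrow> 'v::ab_group_add \<Rightarrow> 'v" (infixr "\<cdot>" 75) and D H Q +
  assumes definite: "x \<in> D \<Longrightarrow> H x x = 0 \<Longrightarrow> x = 0"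
    and complete: "(\<And>n. u n \<in> D) \<Longrightarrow>
      (\<And>e. e > 0 \<Longrightarrow> \<exists>M. \<forall>i\<ge>M. \<forall>j\<ge>M. H (u i - u j) (u i - u j) + Q (u i - u j) (u i - u j) < e) \<Longrightarrow>
      \<exists>f\<in>D. (\<lambda>n. H (u n - f) (u n - f) + Q (u n - f) (u n - f)) \<longlonglongrightarrow> 0"
    and compact: "(\<And>n. u n \<in> D) \<Longrightarrow> (\<And>n. H (u n) (u n) + Q (u n) (u n) \<le> K) \<Longrightarrow>
      \<exists>r::nat \<Rightarrow> nat. strict_mono r \<and>
        (\<forall>e>0. \<exists>M. \<forall>i\<ge>M. \<forall>j\<ge>M. H (u (r i) - u (r j)) (u (r i) - u (r j)) < e)"
begin

definition perp :: "'v set \<Rightarrow> 'v set" where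
  "perp S = {w \<in> D. \<forall>s\<in>S. H w s = 0}"

text \<open>This is minimality of the Rayleigh quotient on \<open>perp S\<close>, multiplied out so
  that \<open>w = 0\<close> needs no special treatment.\<close>

definition is_minimizer :: "'v set \<Rightarrow> 'v \<Rightarrow> bool" where
  "is_minimizer S v \<longleftrightarrow> v \<in> perp S \<and> H v v = 1 \<and> (\<forall>w\<in>perp S. Q v v * H w w \<le> Q w w)"

lemma perp_subset: "perp S \<subseteq> D"
  by (auto simp: perp_def)

lemma subspace_perp: "S \<subseteq> D \<Longrightarrow> H.subspace (perp S)"
  by (rule H.subspaceI)
     (auto simp: perp_def H.D_closed H.zero_left H.add_left H.scale_left subset_iff)

lemma normalize:
  assumes "w \<in> D" "w \<noteq> 0"
  shows "H ((1 / sqrt (H w w)) \<cdot> w) ((1 / sqrt (H w w)) \<cdot> w) = 1"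
proof -
  have "H w w > 0" using definite H.nonneg assms by (metis less_eq_real_def)
  then show ?thesis using assms by (simp add: H.square_scale field_simps)
qed

text \<open>The direct method: compactness makes a minimizing sequence \<open>H\<close>-Cauchy along
  a subsequence, minimality upgrades this to Cauchy in the form norm, and completeness provides a
  limit, to which the constraints and the value of \<open>Q\<close> pass.\<close>

lemma minimizer_exists:
  assumes S: "S \<subseteq> D" and w: "w \<in> perp S" "w \<noteq> 0"
  shows "\<exists>v. is_minimizer S v"
proof -
  let ?C = "perp S"
  note sub = subspace_perp[OF S]
  have inD: "x \<in> ?C \<Longrightarrow> x \<in> D" for x using perp_subset by blast
  define V where "V = {Q x x | x. x \<in> ?C \<and> H x x = 1}"
  define \<mu> where "\<mu> = Inf V"
  have "V \<noteq> {}"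
    using normalize[OF inD[OF w(1)] w(2)] H.subspace_scale[OF sub w(1)] unfolding V_def by blast
  have bdd: "bdd_below V"
    by (rule bdd_belowI[of _ 0]) (auto simp: V_def intro: Q.nonneg inD)
  have \<mu>0: "\<mu> \<ge> 0"
    unfolding \<mu>_def by (rule cInf_greatest) (use \<open>V \<noteq> {}\<close> in \<open>auto simp: V_def intro: Q.nonneg inD\<close>)
  have lower: "\<mu> * H x x \<le> Q x x" if x: "x \<in> ?C" for x
  proof (cases "x = 0")
    case True
    then show ?thesis by (simp add: H.zero_left Q.zero_left H.D_closed)
  next
    case False
    let ?y = "(1 / sqrt (H x x)) \<cdot> x"
    have pos: "H x x > 0" using definite H.nonneg inD[OF x] False by (metis less_eq_real_def)
    have "Q ?y ?y \<in> V"
      using normalize[OF inD[OF x] False] H.subspace_scale[OF sub x] unfolding V_def by blast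
    then have "\<mu> \<le> Q ?y ?y" unfolding \<mu>_def by (rule cInf_lower[OF _ bdd])
    also have "\<dots> = Q x x / H x x" using pos inD[OF x] by (simp add: Q.square_scale field_simps)
    finally show ?thesis using pos by (simp add: field_simps)
  qed
  have "\<exists>x. x \<in> ?C \<and> H x x = 1 \<and> Q x x < \<mu> + inverse (real (Suc k))" for k
  proof -
    have "Inf V < \<mu> + inverse (real (Suc k))" unfolding \<mu>_def by simp
    then obtain y where "y \<in> V" "y < \<mu> + inverse (real (Suc k))"
      using cInf_lessD[OF \<open>V \<noteq> {}\<close>] by blast
    then show ?thesis unfolding V_def by blast
  qed
  then obtain u where u: "\<And>k. u k \<in> ?C" "\<And>k. H (u k) (u k) = 1"
      "\<And>k. Q (u k) (u k) < \<mu> + inverse (real (Suc k))" by metis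
  have "H (u k) (u k) + Q (u k) (u k) \<le> \<mu> + 2" for k
  proof -
    have "inverse (real (Suc k)) \<le> 1" by (simp add: field_simps)
    then show ?thesis using u(2,3)[of k] by linarith
  qed
  then obtain r :: "nat \<Rightarrow> nat" where r: "strict_mono r"
    "\<And>e. e > 0 \<Longrightarrow> \<exists>M. \<forall>i\<ge>M. \<forall>j\<ge>M. H (u (r i) - u (r j)) (u (r i) - u (r j)) < e"
    using compact[of u "\<mu> + 2"] u(1) inD by blast
  define v where "v = (\<lambda>k. u (r k))"
  have v: "v k \<in> ?C" "v k \<in> D" "H (v k) (v k) = 1" for k using u inD by (auto simp: v_def)
  have Qv_less: "Q (v k) (v k) - \<mu> < inverse (real (Suc k))" for k
  proof -
    have "inverse (real (Suc (r k))) \<le> inverse (real (Suc k))"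
      using seq_suble[OF r(1), of k] by (intro le_imp_inverse_le) auto
    then show ?thesis using u(3)[of "r k"] unfolding v_def by linarith
  qed
  have Qv: "(\<lambda>k. Q (v k) (v k)) \<longlonglongrightarrow> \<mu>"
  proof (rule tendsto_sandwich[of "\<lambda>_. \<mu>" _ _ "\<lambda>k. \<mu> + inverse (real (Suc k))"])
    show "(\<lambda>k. \<mu> + inverse (real (Suc k))) \<longlonglongrightarrow> \<mu>"
      using tendsto_add[OF tendsto_const LIMSEQ_inverse_real_of_nat, of \<mu>] by simp
  qed (use lower[OF v(1)] Qv_less v(3) in \<open>auto intro!: always_eventually simp: less_imp_le algebra_simps\<close>)
  \<comment> \<open>The parallelogram law turns smallness of \<open>H (v i - v j)\<close> and near-minimality into
    smallness of \<open>Q (v i - v j)\<close>, since \<open>v i + v j\<close> is again a competitor.\<close>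
  have Qdiff: "Q (v i - v j) (v i - v j) \<le>
      2 * (Q (v i) (v i) - \<mu>) + 2 * (Q (v j) (v j) - \<mu>) + \<mu> * H (v i - v j) (v i - v j)" for i j
  proof -
    have "\<mu> * H (v i + v j) (v i + v j) \<le> Q (v i + v j) (v i + v j)"
      by (intro lower H.subspace_add[OF sub] v)
    moreover have "H (v i + v j) (v i + v j) = 4 - H (v i - v j) (v i - v j)"
      using H.parallelogram[of "v i" "v j"] v by simp
    ultimately show ?thesis
      using Q.parallelogram[of "v i" "v j"] v by (simp add: algebra_simps)
  qed
  have "\<exists>f\<in>D. (\<lambda>n. H (v n - f) (v n - f) + Q (v n - f) (v n - f)) \<longlonglongrightarrow> 0"
  proof (rule complete)
    show "v n \<in> D" for n by (rule v)
    fix e :: real assume e: "e > 0"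
    \<comment> \<open>By \<open>Qdiff\<close> the form norm squared is at most \<open>p\<close>
      times the \<open>H\<close>-part plus twice the two excesses over \<open>\<mu>\<close>. The
      threshold \<open>d\<close> bounds the first by \<open>e / 2\<close>, and excesses below
      \<open>e / 8\<close> contribute less than \<open>e / 2\<close>.\<close>
    define p where "p = 1 + \<mu>"
    define d where "d = e / (2 * p)"
    have "p > 0" using \<mu>0 by (simp add: p_def)
    then have d: "d > 0" "p * d = e / 2" using e unfolding d_def by simp_all
    obtain M1 where M1: "\<And>i j. i \<ge> M1 \<Longrightarrow> j \<ge> M1 \<Longrightarrow> H (v i - v j) (v i - v j) < d"
      using r(2)[OF d(1)] unfolding v_def by blast
    have "e / 8 > 0" using e by simp
    then obtain M2 where "\<And>i. i \<ge> M2 \<Longrightarrow> \<bar>Q (v i) (v i) - \<mu>\<bar> < e / 8"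
      using LIMSEQ_D[OF Qv, of "e / 8"] unfolding real_norm_def by blast
    then have M2: "Q (v i) (v i) - \<mu> < e / 8" if "i \<ge> M2" for i
      using that abs_less_iff by blast
    have "H (v i - v j) (v i - v j) + Q (v i - v j) (v i - v j) < e"
      if "i \<ge> max M1 M2" "j \<ge> max M1 M2" for i j
    proof -
      have "p * H (v i - v j) (v i - v j) \<le> e / 2"
        using mult_left_mono[of "H (v i - v j) (v i - v j)" d p] M1[of i j] that \<open>p > 0\<close> d(2)
        by simp
      then show ?thesis
        using Qdiff[of i j] M2[of i] M2[of j] that by (simp add: p_def distrib_right)
    qed
    then show "\<exists>M. \<forall>i\<ge>M. \<forall>j\<ge>M. H (v i - v j) (v i - v j) + Q (v i - v j) (v i - v j) < e"
      by blast
  qed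
  then obtain f where f: "f \<in> D"
    and lim: "(\<lambda>n. H (v n - f) (v n - f) + Q (v n - f) (v n - f)) \<longlonglongrightarrow> 0" by blast
  have dD: "v n - f \<in> D" for n using v f by (simp add: H.D_closed)
  have limH: "(\<lambda>n. H (v n - f) (v n - f)) \<longlonglongrightarrow> 0"
    by (rule tendsto_sandwich[OF _ _ tendsto_const lim])
       (use H.nonneg[OF dD] Q.nonneg[OF dD] in \<open>auto intro!: always_eventually\<close>)
  have limQ: "(\<lambda>n. Q (v n - f) (v n - f)) \<longlonglongrightarrow> 0"
    by (rule tendsto_sandwich[OF _ _ tendsto_const lim])
       (use H.nonneg[OF dD] Q.nonneg[OF dD] in \<open>auto intro!: always_eventually\<close>)
  have "H f s = 0" if "s \<in> S" for s
  proof -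
    have "(\<lambda>n. H (v n) s) \<longlonglongrightarrow> H f s"
      using that S by (intro H.tendsto_left v f limH) auto
    moreover have "H (v n) s = 0" for n using v(1)[of n] that by (simp add: perp_def)
    ultimately show ?thesis by (simp add: LIMSEQ_const_iff)
  qed
  then have "f \<in> perp S" using f by (simp add: perp_def)
  moreover have "H f f = 1"
    using H.tendsto_square[OF v(2) f limH] v(3) by (simp add: LIMSEQ_const_iff)
  moreover have "Q f f = \<mu>"
    using LIMSEQ_unique[OF Q.tendsto_square[OF v(2) f limQ] Qv] .
  ultimately show ?thesis using lower unfolding is_minimizer_def by metis
qed

text \<open>The Euler--Lagrange equation: \<open>v\<close> is a null vector of the positive semidefinite form
  \<open>Q - Q v v * H\<close> on \<open>perp S\<close>.\<close>

lemma minimizer_weak_eigenvector: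
  assumes S: "S \<subseteq> D" and v: "is_minimizer S v" and w: "w \<in> perp S"
  shows "Q v w = Q v v * H v w"
proof -
  interpret R: psd_form scale "perp S" "\<lambda>x y. Q x y - Q v v * H x y"
  proof unfold_locales
    show "H.subspace (perp S)" by (rule subspace_perp[OF S])
    have inD: "x \<in> perp S \<Longrightarrow> x \<in> D" for x using perp_subset by blast
    show "Q x y - Q v v * H x y = Q y x - Q v v * H y x" if "x \<in> perp S" "y \<in> perp S" for x y
      using that by (simp add: inD H.sym[of x y] Q.sym[of x y])
    show "Q (x + y) z - Q v v * H (x + y) z = Q x z - Q v v * H x z + (Q y z - Q v v * H y z)"
      if "x \<in> perp S" "y \<in> perp S" "z \<in> perp S" for x y z
      using that by (simp add: inD H.add_left Q.add_left algebra_simps)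
    show "Q (r \<cdot> x) y - Q v v * H (r \<cdot> x) y = r * (Q x y - Q v v * H x y)"
      if "x \<in> perp S" "y \<in> perp S" for r x y
      using that by (simp add: inD H.scale_left Q.scale_left algebra_simps)
    show "0 \<le> Q x x - Q v v * H x x" if "x \<in> perp S" for x
      using that v by (simp add: is_minimizer_def)
  qed
  have "(Q v w - Q v v * H v w)\<^sup>2 \<le> 0"
    using R.cauchy_schwarz[of v w] v w by (simp add: is_minimizer_def)
  then show ?thesis by simp
qed

text \<open>Each vector minimizes \<open>Q\<close> on the orthogonal complement of its predecessors.
  Choice makes the recursion total before it is known where minimizers exist.\<close>

function ev :: "nat \<Rightarrow> 'v" where
  "ev n = (SOME v. is_minimizer (ev ` {..<n}) v)"
  by auto
termination by (relation less_than) auto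

declare ev.simps [simp del]

definition lam :: "nat \<Rightarrow> real" where "lam n = Q (ev n) (ev n)"

text \<open>The minimization succeeds exactly for the indices below the dimension of \<open>D\<close>; outside
  \<open>J\<close> the value of \<open>ev\<close> is unspecified.\<close>

definition J :: "nat set" where
  "J = {n. ev ` {..<n} \<subseteq> D \<and> (\<exists>w \<in> perp (ev ` {..<n}). w \<noteq> 0)}"

section \<open>Orthonormality of the successive minimizers\<close>

lemma J_minimizer:
  assumes "n \<in> J"
  shows "is_minimizer (ev ` {..<n}) (ev n)"
proof -
  have "\<exists>v. is_minimizer (ev ` {..<n}) v"
    using assms minimizer_exists[of "ev ` {..<n}"] unfolding J_def by blast
  then show ?thesis unfolding ev.simps[of n] by (rule someI_ex)
qed

lemma perp_antimono: "S \<subseteq> T \<Longrightarrow> perp T \<subseteq> perp S"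
  by (auto simp: perp_def)

lemma J_downward:
  assumes "n \<in> J" "k \<le> n"
  shows "k \<in> J"
proof -
  have "ev ` {..<k} \<subseteq> ev ` {..<n}" using assms(2) by (intro image_mono) auto
  then show ?thesis using assms(1) perp_antimono unfolding J_def by blast
qed

lemma ev_in: "n \<in> J \<Longrightarrow> ev n \<in> D"
  using J_minimizer by (auto simp: is_minimizer_def perp_def)

lemma ev_norm: "n \<in> J \<Longrightarrow> H (ev n) (ev n) = 1"
  using J_minimizer by (auto simp: is_minimizer_def)

lemma ev_orth:
  assumes "n \<in> J" "k \<in> J" "n \<noteq> k"
  shows "H (ev n) (ev k) = 0"
proof -
  have *: "H (ev i) (ev j) = 0" if "i \<in> J" "j < i" for i j
    using J_minimizer[OF that(1)] that(2) by (auto simp: is_minimizer_def perp_def)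
  show ?thesis
    using assms *[of n k] *[of k n] by (metis H.sym ev_in linorder_neqE_nat)
qed

lemma ev_inner: "n \<in> J \<Longrightarrow> k \<in> J \<Longrightarrow> H (ev n) (ev k) = (if n = k then 1 else 0)"
  by (simp add: ev_norm ev_orth)

section \<open>Orthogonal projections onto finitely many minimizers\<close>

definition proj :: "nat set \<Rightarrow> 'v \<Rightarrow> 'v" where
  "proj I w = (\<Sum>i\<in>I. H w (ev i) \<cdot> ev i)"

lemma proj_in: "I \<subseteq> J \<Longrightarrow> proj I w \<in> D"
  unfolding proj_def by (intro H.D_closed) (auto simp: ev_in)

lemma proj_inner:
  assumes "finite I" "I \<subseteq> J" "w \<in> D" "k \<in> J"
  shows "H (proj I w) (ev k) = (if k \<in> I then H w (ev k) else 0)"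
proof -
  have "H (proj I w) (ev k) = (\<Sum>i\<in>I. H w (ev i) * H (ev i) (ev k))"
    using assms unfolding proj_def
    by (subst H.sum_left) (auto simp: ev_in H.D_closed H.scale_left subset_iff intro!: sum.cong)
  also have "\<dots> = (\<Sum>i\<in>I. if k = i then H w (ev k) else 0)"
    using assms by (intro sum.cong) (auto simp: ev_inner subset_iff)
  finally show ?thesis using assms by simp
qed

lemma residual_orth:
  assumes "finite I" "I \<subseteq> J" "w \<in> D" "k \<in> I"
  shows "H (w - proj I w) (ev k) = 0"
proof -
  have "k \<in> J" using assms by auto
  then show ?thesis
    using assms by (simp add: H.diff_left ev_in proj_in proj_inner)
qed

lemma residual_perp:
  "{..<n} \<subseteq> J \<Longrightarrow> w \<in> D \<Longrightarrow> w - proj {..<n} w \<in> perp (ev ` {..<n})"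
  unfolding perp_def using residual_orth[of "{..<n}" w] by (auto simp: H.D_closed proj_in)

lemma J_lessThan: "n \<in> J \<Longrightarrow> {..<n} \<subseteq> J"
  using J_downward by (auto simp: less_imp_le)

text \<open>The Euler-Lagrange equation covers only test vectors orthogonal to the predecessors. The
  remaining component \<open>?p\<close> is a combination of predecessors, against which both sides
  vanish: by induction and symmetry
  \<open>Q (ev n) (ev j) = lam j * H (ev j) (ev n) = 0\<close>.\<close>

lemma ev_weak_eigenvector:
  assumes "n \<in> J" "w \<in> D"
  shows "Q (ev n) w = lam n * H (ev n) w"
  using assms
proof (induction n arbitrary: w rule: less_induct)
  case (less n)
  note J' = J_lessThan[OF less.prems(1)]
  let ?S = "ev ` {..<n}"
  have S: "?S \<subseteq> D" using J' by (auto simp: ev_in)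
  note min = J_minimizer[OF less.prems(1)]
  let ?p = "proj {..<n} w"
  have p: "?p \<in> D" by (rule proj_in[OF J'])
  have "Q (ev n) (ev j) = 0" if "j < n" for j
  proof -
    have "j \<in> J" using J' that by auto
    then have "Q (ev j) (ev n) = 0"
      using less.IH[OF that, of "ev n"] less.prems(1) that by (simp add: ev_in ev_orth)
    then show ?thesis using Q.sym ev_in less.prems(1) \<open>j \<in> J\<close> by metis
  qed
  then have "Q (ev n) ?p = 0"
    unfolding proj_def using J' less.prems(1)
    by (subst Q.sum_right) (auto simp: ev_in H.D_closed Q.scale_right subset_iff)
  moreover have "H (ev n) ?p = 0"
    using H.sym[OF p ev_in[OF less.prems(1)]] proj_inner[of "{..<n}" w n] J' less.prems by simp
  moreover have "Q (ev n) (w - ?p) = lam n * H (ev n) (w - ?p)"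
    unfolding lam_def
    by (rule minimizer_weak_eigenvector[OF S min residual_perp[OF J' less.prems(2)]])
  ultimately show ?case
    using less.prems p by (simp add: Q.diff_right H.diff_right ev_in)
qed

lemma lam_nonneg: "n \<in> J \<Longrightarrow> 0 \<le> lam n"
  unfolding lam_def by (intro Q.nonneg ev_in)

lemma lam_le:
  assumes "n \<in> J" "w \<in> D" "\<And>j. j < n \<Longrightarrow> H w (ev j) = 0"
  shows "lam n * H w w \<le> Q w w"
  using J_minimizer[OF assms(1)] assms(2,3) by (auto simp: is_minimizer_def perp_def lam_def)

lemma lam_mono:
  assumes "n \<in> J" "k \<le> n"
  shows "lam k \<le> lam n"
proof -
  have k: "k \<in> J" using J_downward assms by blast
  have "lam k * H (ev n) (ev n) \<le> Q (ev n) (ev n)"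
    using assms k J_downward[OF k] by (intro lam_le) (auto simp: ev_in ev_orth)
  then show ?thesis using assms by (simp add: ev_norm lam_def)
qed

lemma proj_Q:
  assumes "finite I" "I \<subseteq> J" "w \<in> D" "z \<in> D"
  shows "Q (proj I w) z = (\<Sum>i\<in>I. lam i * H w (ev i) * H (ev i) z)"
  using assms unfolding proj_def
  by (subst Q.sum_left)
     (auto simp: ev_in H.D_closed Q.scale_left subset_iff ev_weak_eigenvector intro!: sum.cong)

lemma proj_H:
  assumes "finite I" "I \<subseteq> J" "w \<in> D" "z \<in> D"
  shows "H (proj I w) z = (\<Sum>i\<in>I. H w (ev i) * H (ev i) z)"
  using assms unfolding proj_def
  by (subst H.sum_left) (auto simp: ev_in H.D_closed H.scale_left subset_iff intro!: sum.cong)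

text \<open>The residual is orthogonal to the projection for \<open>H\<close> and, because the
  \<open>ev i\<close> are weak eigenvectors, also for \<open>Q\<close>; hence both squares
  split.\<close>

lemma pythagoras:
  assumes "finite I" "I \<subseteq> J" "w \<in> D"
  shows "H w w = (\<Sum>i\<in>I. (H w (ev i))\<^sup>2) + H (w - proj I w) (w - proj I w)"
    and "Q w w = (\<Sum>i\<in>I. lam i * (H w (ev i))\<^sup>2) + Q (w - proj I w) (w - proj I w)"
proof -
  let ?p = "proj I w" and ?r = "w - proj I w"
  have p: "?p \<in> D" using assms proj_in by auto
  have r: "?r \<in> D" using assms p by (simp add: H.D_closed)
  have r0: "H (ev i) ?r = 0" if "i \<in> I" for i
    using residual_orth[OF assms that] that assms r H.sym ev_in by (metis subsetD)
  have "H ?p ?r = 0" "Q ?p ?r = 0"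
    using proj_H[OF assms r] proj_Q[OF assms r] r0 by auto
  moreover have "H ?p ?p = H ?p w - H ?p ?r" "Q ?p ?p = Q ?p w - Q ?p ?r"
    using p assms(3) by (auto simp: H.diff_right Q.diff_right)
  moreover have "H ?p w = (\<Sum>i\<in>I. (H w (ev i))\<^sup>2)" "Q ?p w = (\<Sum>i\<in>I. lam i * (H w (ev i))\<^sup>2)"
    using proj_H[OF assms assms(3)] proj_Q[OF assms assms(3)] assms
    by (auto intro!: sum.cong simp: H.sym[OF _ assms(3)] ev_in power2_eq_square subset_iff)
  moreover have "H w w = H ?p ?p + 2 * H ?p ?r + H ?r ?r" "Q w w = Q ?p ?p + 2 * Q ?p ?r + Q ?r ?r"
    using H.square_add[OF p r] Q.square_add[OF p r] by (simp_all add: algebra_simps)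
  ultimately show "H w w = (\<Sum>i\<in>I. (H w (ev i))\<^sup>2) + H ?r ?r"
    "Q w w = (\<Sum>i\<in>I. lam i * (H w (ev i))\<^sup>2) + Q ?r ?r" by simp_all
qed

lemma bessel:
  assumes "finite I" "I \<subseteq> J" "w \<in> D"
  shows "(\<Sum>i\<in>I. (H w (ev i))\<^sup>2) \<le> H w w"
  using pythagoras(1)[OF assms] H.nonneg[of "w - proj I w"] assms
  by (simp add: H.D_closed proj_in)

text \<open>An orthonormal sequence with bounded \<open>Q\<close> would have an \<open>H\<close>-convergent subsequence.\<close>

lemma finite_lam_le: "finite {n \<in> J. lam n \<le> K}"
proof (rule ccontr)
  assume inf: "infinite {n \<in> J. lam n \<le> K}"
  define s where "s = enumerate {n \<in> J. lam n \<le> K}"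
  have s: "s n \<in> J" "lam (s n) \<le> K" for n
    using enumerate_in_set[OF inf, of n] by (auto simp: s_def)
  have inj: "s i = s j \<longleftrightarrow> i = j" for i j
    unfolding s_def using strict_mono_enumerate[OF inf] by (simp add: strict_mono_eq)
  have "\<exists>r::nat \<Rightarrow> nat. strict_mono r \<and> (\<forall>e>0. \<exists>M. \<forall>i\<ge>M. \<forall>j\<ge>M.
      H (ev (s (r i)) - ev (s (r j))) (ev (s (r i)) - ev (s (r j))) < e)"
    using compact[of "\<lambda>n. ev (s n)" "1 + K"] s by (simp add: ev_in ev_norm lam_def)
  then obtain r :: "nat \<Rightarrow> nat" and M where r: "strict_mono r"
    and M: "\<And>i j. i \<ge> M \<Longrightarrow> j \<ge> M \<Longrightarrow>
      H (ev (s (r i)) - ev (s (r j))) (ev (s (r i)) - ev (s (r j))) < 1"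
    using zero_less_one by blast
  have "r M \<noteq> r (Suc M)" using strict_monoD[OF r, of M "Suc M"] by simp
  then have "H (ev (s (r M)) - ev (s (r (Suc M)))) (ev (s (r M)) - ev (s (r (Suc M)))) = 2"
    using s by (simp add: H.square_diff ev_in ev_norm ev_orth inj)
  then show False using M[of M "Suc M"] by simp
qed

section \<open>Completeness of the system of eigenvectors\<close>

lemma not_in_J:
  assumes "{..<n} \<subseteq> J" "n \<notin> J" "w \<in> D"
  shows "w = proj {..<n} w"
proof -
  have "ev ` {..<n} \<subseteq> D" using assms by (auto simp: ev_in)
  then have "w - proj {..<n} w = 0"
    using assms residual_perp[OF assms(1,3)] unfolding J_def by auto
  then show ?thesis by simp
qed

lemma J_cases:
  obtains "J = UNIV" | N where "J = {..<N}"
proof (cases "J = UNIV")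
  case False
  then have ex: "\<exists>n. n \<notin> J" by auto
  define N where "N = (LEAST n. n \<notin> J)"
  have "N \<notin> J" unfolding N_def using LeastI_ex[OF ex] .
  moreover have "k \<in> J" if "k < N" for k using not_less_Least that unfolding N_def by blast
  ultimately have "J = {..<N}" using J_downward by (auto simp: not_less) (meson not_less)
  then show ?thesis by (rule that(2))
qed (rule that(1))

text \<open>If \<open>J\<close> is finite, the residual eventually is zero. Otherwise the residual
  \<open>r\<close> after \<open>N\<close> vectors satisfies
  \<open>lam N * H r r \<le> Q r r \<le> Q w w\<close>, by minimality and by Pythagoras for
  \<open>Q\<close>, while \<open>lam\<close> is unbounded by \<open>finite_lam_le\<close>.\<close>

lemma residual_small:
  assumes w: "w \<in> D" and e: "\<epsilon> > 0"
  shows "\<exists>N. {..<N} \<subseteq> J \<and> H (w - proj {..<N} w) (w - proj {..<N} w) < \<epsilon>"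
proof (cases rule: J_cases)
  case 1
  \<comment> \<open>Chosen such that \<open>K * \<epsilon> = Q w w + \<epsilon>\<close> exceeds
    \<open>Q w w\<close>.\<close>
  define K where "K = Q w w / \<epsilon> + 1"
  have "K > 0" using Q.nonneg[OF w] e by (simp add: K_def add_nonneg_pos)
  have "finite {n. lam n \<le> K}" using finite_lam_le[of K] 1 by simp
  then obtain N where N: "lam N > K"
    by (metis (mono_tags, lifting) UNIV_I ex_new_if_finite infinite_UNIV_nat mem_Collect_eq not_less)
  have J: "{..<N} \<subseteq> J" "N \<in> J" using 1 by auto
  let ?r = "w - proj {..<N} w"
  have r: "?r \<in> D" using w J by (simp add: H.D_closed proj_in)
  have "K * H ?r ?r \<le> lam N * H ?r ?r" using N H.nonneg[OF r] by (intro mult_right_mono) auto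
  also have "\<dots> \<le> Q ?r ?r"
    using residual_orth[of "{..<N}" w] J w r by (intro lam_le) auto
  also have "\<dots> \<le> Q w w"
    using pythagoras(2)[of "{..<N}" w] J w lam_nonneg
    by (auto intro!: sum_nonneg mult_nonneg_nonneg)
  also have "\<dots> < K * \<epsilon>" using e by (simp add: K_def field_simps)
  finally have "H ?r ?r < \<epsilon>" using \<open>K > 0\<close> by simp
  then show ?thesis using J by blast
next
  case (2 N)
  then have "w - proj {..<N} w = 0" using not_in_J[of N w] w by simp
  then show ?thesis using 2 e by (intro exI[of _ N]) (simp add: H.zero_left H.D_closed)
qed

text \<open>Together with \<open>bessel\<close> this is Parseval's identity. The formulation by
  initial segments treats finite and infinite \<open>J\<close> alike.\<close>

lemma parseval:
  assumes w: "w \<in> D" and e: "\<epsilon> > 0"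
  shows "\<exists>N. {..<N} \<subseteq> J \<and> H w w - \<epsilon> < (\<Sum>n<N. (H w (ev n))\<^sup>2)"
proof -
  obtain N where N: "{..<N} \<subseteq> J" "H (w - proj {..<N} w) (w - proj {..<N} w) < \<epsilon>"
    using residual_small[OF assms] by blast
  then show ?thesis using pythagoras(1)[of "{..<N}" w] w by (intro exI[of _ N]) auto
qed

lemma orth_all_zero:
  assumes "w \<in> D" "\<And>n. n \<in> J \<Longrightarrow> H w (ev n) = 0"
  shows "w = 0"
proof (rule ccontr)
  assume "w \<noteq> 0"
  then have pos: "H w w > 0" using definite H.nonneg assms(1) by (metis less_eq_real_def)
  obtain N where "{..<N} \<subseteq> J" "H w w - H w w < (\<Sum>n<N. (H w (ev n))\<^sup>2)"
    using parseval[OF assms(1) pos] by blast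
  moreover from this(1) have "(\<Sum>n<N. (H w (ev n))\<^sup>2) = 0" using assms(2) by (intro sum.neutral) auto
  ultimately show False by simp
qed

text \<open>Testing \<open>f\<close> with \<open>ev n\<close> gives
  \<open>lam n * H (ev n) f = t * H (ev n) f\<close>, so \<open>f\<close> is orthogonal to all
  \<open>ev n\<close> with \<open>lam n \<noteq> t\<close>. Subtracting its projection onto the
  finitely many others leaves a vector orthogonal to the whole system, which is zero.\<close>

lemma weak_eigenspace:
  "{f \<in> D. \<forall>g\<in>D. Q g f = t * H g f} = H.span (ev ` {n \<in> J. lam n = t})"
    (is "?E = H.span (ev ` ?I)")
proof
  have fin: "finite ?I" by (rule finite_subset[OF _ finite_lam_le[of t]]) auto
  show "?E \<subseteq> H.span (ev ` ?I)"
  proof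
    fix f assume "f \<in> ?E"
    then have f: "f \<in> D" "\<And>g. g \<in> D \<Longrightarrow> Q g f = t * H g f" by auto
    have p: "proj ?I f \<in> D" by (intro proj_in) auto
    have "H (f - proj ?I f) (ev n) = 0" if n: "n \<in> J" for n
    proof (cases "lam n = t")
      case True
      then show ?thesis using n f fin by (intro residual_orth) auto
    next
      case False
      have "lam n * H (ev n) f = t * H (ev n) f"
        using ev_weak_eigenvector[OF n f(1)] f(2)[OF ev_in[OF n]] by metis
      then have "H (ev n) f = 0" using False by simp
      then show ?thesis
        using n f(1) p False fin
        by (simp add: H.diff_left ev_in proj_inner H.sym[of f])
    qed
    then have "f = proj ?I f" using orth_all_zero[of "f - proj ?I f"] f(1) p by (simp add: H.D_closed)
    also have "\<dots> \<in> H.span (ev ` ?I)"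
      unfolding proj_def by (intro H.span_sum H.span_scale H.span_base) auto
    finally show "f \<in> H.span (ev ` ?I)" .
  qed
  have "H.subspace ?E"
    by (rule H.subspaceI)
       (auto simp: H.D_closed H.zero_right Q.zero_right H.add_right Q.add_right
         H.scale_right Q.scale_right algebra_simps)
  moreover have "ev ` ?I \<subseteq> ?E"
    using ev_weak_eigenvector by (auto simp: ev_in) (metis H.sym Q.sym ev_in)
  ultimately show "H.span (ev ` ?I) \<subseteq> ?E" by (rule H.span_minimal[rotated])
qed

section \<open>Linear independence of the eigenvectors, and the inequalities of Ky Fan and
  Courant-Fischer\<close>

lemma inj_on_ev: "inj_on ev J"
  by (rule inj_onI) (metis ev_inner zero_neq_one)

lemma independent_ev:
  assumes I: "I \<subseteq> J"
  shows "H.independent (ev ` I)"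
proof
  assume "H.dependent (ev ` I)"
  then obtain T u v where T: "finite T" "T \<subseteq> ev ` I" "(\<Sum>v\<in>T. u v \<cdot> v) = 0" "v \<in> T" "u v \<noteq> 0"
    unfolding H.dependent_explicit by blast
  then obtain k where k: "k \<in> J" "v = ev k" using I by auto
  have TJ: "w \<in> T \<Longrightarrow> \<exists>n\<in>J. w = ev n" for w using T(2) I by auto
  have TD: "w \<in> T \<Longrightarrow> w \<in> D" for w using TJ[of w] ev_in by blast
  have "0 = H (\<Sum>w\<in>T. u w \<cdot> w) v" using T(3) k by (simp add: H.zero_left ev_in)
  also have "\<dots> = (\<Sum>w\<in>T. u w * H w v)"
    using TD T(4) by (subst H.sum_left) (auto simp: H.D_closed H.scale_left)
  also have "\<dots> = (\<Sum>w\<in>T. if v = w then u v else 0)"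
    by (intro sum.cong refl) (use k in \<open>auto simp: ev_inner dest!: TJ split: if_splits\<close>)
  also have "\<dots> = u v" using T by simp
  finally show False using T(5) by simp
qed

text \<open>Let \<open>a n\<close> be the total weight of the vectors \<open>g i\<close> on
  \<open>ev n\<close>. Weight on the first \<open>N\<close> eigenvectors costs
  \<open>lam n * a n\<close>, and the remaining weight \<open>N - (\<Sum>n<N. a n)\<close> costs at
  least the top eigenvalue \<open>lam N'\<close> per unit. As \<open>a n \<le> 1\<close>, moving
  weight from \<open>lam N'\<close> down to the lower levels until each carries weight one can only
  decrease the cost.\<close>

lemma ky_fan_trace_inequality:
  assumes N: "{..<N} \<subseteq> J" and g: "\<And>i. i < N \<Longrightarrow> g i \<in> D"
    and norm: "\<And>i j. i < N \<Longrightarrow> j < N \<Longrightarrow> H (g i) (g j) = (if i = j then 1 else 0)"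
  shows "(\<Sum>n<N. lam n) \<le> (\<Sum>i<N. Q (g i) (g i))"
proof (cases N)
  case (Suc N')
  \<comment> \<open>The tail is estimated with the last index \<open>N' = N - 1\<close>, since
    \<open>N\<close> itself may lie outside \<open>J\<close>.\<close>
  have N': "N' \<in> J" using N Suc by auto
  define a where "a n = (\<Sum>i<N. (H (g i) (ev n))\<^sup>2)" for n
  have a1: "a n \<le> 1" if n: "n < N" for n
  proof -
    have nJ: "n \<in> J" using n N by auto
    \<comment> \<open>This is the projection of \<open>ev n\<close> onto the span of the
      \<open>g i\<close>. Both \<open>H h h\<close> and \<open>H h (ev n)\<close> equal
      \<open>a n\<close>, so the squared distance from \<open>h\<close> to \<open>ev n\<close> is
      \<open>1 - a n\<close>.\<close>
    define h where "h = (\<Sum>i<N. H (g i) (ev n) \<cdot> g i)"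
    have hD: "h \<in> D" unfolding h_def using g by (intro H.D_closed) auto
    have h1: "H h z = (\<Sum>i<N. H (g i) (ev n) * H (g i) z)" if "z \<in> D" for z
      unfolding h_def using g that by (subst H.sum_left) (auto simp: H.D_closed H.scale_left)
    have hg: "H (g i) h = H (g i) (ev n)" if "i < N" for i
    proof -
      have "H h (g i) = (\<Sum>k<N. H (g k) (ev n) * H (g k) (g i))" using h1 g that by simp
      also have "\<dots> = (\<Sum>k<N. if i = k then H (g i) (ev n) else 0)"
        by (intro sum.cong refl) (use that in \<open>auto simp: norm\<close>)
      finally show ?thesis using that g hD by (simp add: H.sym[of "g i"])
    qed
    have "H h h = a n" using h1[OF hD] hg by (simp add: a_def power2_eq_square)
    moreover have "H h (ev n) = a n" using h1[OF ev_in[OF nJ]] by (simp add: a_def power2_eq_square)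
    moreover have "H (h - ev n) (h - ev n) \<ge> 0" using hD nJ by (intro H.nonneg) (simp add: H.D_closed ev_in)
    ultimately show ?thesis using hD nJ by (simp add: H.square_diff ev_in ev_norm)
  qed
  have Qg: "(\<Sum>n<N. lam n * (H (g i) (ev n))\<^sup>2) + lam N' * (1 - (\<Sum>n<N. (H (g i) (ev n))\<^sup>2)) \<le> Q (g i) (g i)"
    if i: "i < N" for i
  proof -
    let ?r = "g i - proj {..<N} (g i)"
    have rD: "?r \<in> D" using g[OF i] N by (simp add: H.D_closed proj_in)
    have "lam N' * H ?r ?r \<le> Q ?r ?r"
      using residual_orth[of "{..<N}" "g i"] N g[OF i] rD N' Suc by (intro lam_le) auto
    moreover have "1 - (\<Sum>n<N. (H (g i) (ev n))\<^sup>2) = H ?r ?r"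
      using pythagoras(1)[of "{..<N}" "g i"] N g[OF i] norm[OF i i] by simp
    moreover have "Q (g i) (g i) = (\<Sum>n<N. lam n * (H (g i) (ev n))\<^sup>2) + Q ?r ?r"
      using pythagoras(2)[of "{..<N}" "g i"] N g[OF i] by simp
    ultimately show ?thesis by simp
  qed
  have "(\<Sum>n<N. lam n) \<le> (\<Sum>n<N. lam n * a n + lam N' * (1 - a n))"
  proof (rule sum_mono)
    fix n assume n: "n \<in> {..<N}"
    have "lam n \<le> lam N'" using lam_mono[OF N'] n Suc by simp
    then have "lam n * (1 - a n) \<le> lam N' * (1 - a n)"
      using a1 n by (intro mult_right_mono) auto
    then show "lam n \<le> lam n * a n + lam N' * (1 - a n)" by (simp add: algebra_simps)
  qed
  also have "\<dots> = (\<Sum>n<N. lam n * a n) + lam N' * (real N - (\<Sum>n<N. a n))"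
    by (simp add: sum.distrib sum_distrib_left sum_subtractf right_diff_distrib)
  also have "\<dots> = (\<Sum>i<N. (\<Sum>n<N. lam n * (H (g i) (ev n))\<^sup>2) + lam N' * (1 - (\<Sum>n<N. (H (g i) (ev n))\<^sup>2)))"
  proof -
    have "(\<Sum>n<N. lam n * a n) = (\<Sum>i<N. \<Sum>n<N. lam n * (H (g i) (ev n))\<^sup>2)"
      unfolding a_def sum_distrib_left by (rule sum.swap)
    moreover have "(\<Sum>n<N. a n) = (\<Sum>i<N. \<Sum>n<N. (H (g i) (ev n))\<^sup>2)"
      unfolding a_def by (rule sum.swap)
    ultimately show ?thesis
      by (simp add: sum.distrib sum_subtractf right_diff_distrib flip: sum_distrib_left)
  qed
  also have "\<dots> \<le> (\<Sum>i<N. Q (g i) (g i))" by (intro sum_mono Qg) auto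
  finally show ?thesis .
qed simp

text \<open>Orthogonality to \<open>ev 0\<close>, ..., \<open>ev (n - 1)\<close> imposes
  \<open>n\<close> conditions on combinations of \<open>n + 1\<close> vectors, so some non-zero
  combination \<open>w\<close> satisfies all of them. For it,
  \<open>lam n * H w w \<le> Q w w \<le> K * H w w\<close>.\<close>

lemma courant_fischer_upper_bound:
  assumes n: "n \<in> J" and g: "\<And>i. i \<le> n \<Longrightarrow> g i \<in> D"
    and norm: "\<And>i j. i \<le> n \<Longrightarrow> j \<le> n \<Longrightarrow> H (g i) (g j) = (if i = j then 1 else 0)"
    and bound: "\<And>a. Q (\<Sum>i\<le>n. a i \<cdot> g i) (\<Sum>i\<le>n. a i \<cdot> g i) \<le> K * (\<Sum>i\<le>n. (a i)\<^sup>2)"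
  shows "lam n \<le> K"
proof -
  obtain a where a: "\<exists>i\<in>{..n}. a i \<noteq> 0" "\<forall>j<n. (\<Sum>i\<in>{..n}. a i * H (g i) (ev j)) = 0"
    using homogeneous_system_nontrivial[of "{..n}" n "\<lambda>j i. H (g i) (ev j)"] by auto
  let ?w = "\<Sum>i\<le>n. a i \<cdot> g i"
  have w: "?w \<in> D" using g by (intro H.D_closed) auto
  have Hw: "H ?w z = (\<Sum>i\<le>n. a i * H (g i) z)" if "z \<in> D" for z
    using g that by (subst H.sum_left) (auto simp: H.D_closed H.scale_left)
  have "H ?w (g i) = a i" if "i \<le> n" for i
  proof -
    have "H ?w (g i) = (\<Sum>k\<le>n. if i = k then a i else 0)"
      unfolding Hw[OF g[OF that]] by (intro sum.cong refl) (use norm that in auto)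
    then show ?thesis using that by simp
  qed
  then have "H (g i) ?w = a i" if "i \<le> n" for i
    using H.sym[OF w g[OF that]] that by simp
  then have ww: "H ?w ?w = (\<Sum>i\<le>n. (a i)\<^sup>2)"
    using Hw[OF w] by (simp add: power2_eq_square)
  have "H ?w (ev j) = 0" if "j < n" for j
    using that a(2) Hw[OF ev_in] J_downward[OF n] by simp
  then have "lam n * H ?w ?w \<le> Q ?w ?w" by (intro lam_le n w)
  also have "\<dots> \<le> K * H ?w ?w" using bound[of a] ww by simp
  finally have le: "lam n * H ?w ?w \<le> K * H ?w ?w" .
  have "H ?w ?w > 0" unfolding ww using a(1) by (auto intro!: sum_pos2)
  then show ?thesis using le by simp
qed

text \<open>\<open>Q\<close> is diagonal in the eigenvectors. The estimate provides the hypothesis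
  \<open>bound\<close> of the preceding lemma when a smaller form is compared with
  \<open>Q\<close>.\<close>

lemma Q_combination_le:
  assumes n: "n \<in> J"
  shows "Q (\<Sum>i\<le>n. a i \<cdot> ev i) (\<Sum>i\<le>n. a i \<cdot> ev i) \<le> lam n * (\<Sum>i\<le>n. (a i)\<^sup>2)"
proof -
  let ?w = "\<Sum>i\<le>n. a i \<cdot> ev i"
  have J': "i \<le> n \<Longrightarrow> i \<in> J" for i using J_downward[OF n] by blast
  have w: "?w \<in> D" using J' by (intro H.D_closed) (auto simp: ev_in)
  have Hw: "H (ev i) ?w = a i" if "i \<le> n" for i
  proof -
    have "H (ev i) ?w = (\<Sum>k\<le>n. a k * H (ev i) (ev k))"
      using J' that by (subst H.sum_right) (auto simp: ev_in H.D_closed H.scale_right)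
    also have "\<dots> = (\<Sum>k\<le>n. if i = k then a i else 0)"
      by (intro sum.cong refl) (use J' that in \<open>auto simp: ev_inner\<close>)
    finally show ?thesis using that by simp
  qed
  have "Q ?w ?w = (\<Sum>i\<le>n. lam i * (a i)\<^sup>2)"
    using J' w
    by (subst Q.sum_left) (auto simp: ev_in H.D_closed Q.scale_left ev_weak_eigenvector Hw
        power2_eq_square intro!: sum.cong)
  also have "\<dots> \<le> (\<Sum>i\<le>n. lam n * (a i)\<^sup>2)"
    using lam_mono[OF n] by (intro sum_mono mult_right_mono) auto
  finally show ?thesis by (simp add: sum_distrib_left)
qed

end

section \<open>Energy forms as weighted sums of squares\<close>

text \<open>The index type is arbitrary so that one calculus serves three cases:
  \<open>ell2 m\<close>, the killing term with weight \<open>c\<close>, and the edge sum over pairs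
  with weight \<open>case_prod b\<close> and argument \<open>grad f\<close>.\<close>

definition wdom :: "('i \<Rightarrow> real) \<Rightarrow> ('i \<Rightarrow> real) set" where
  "wdom w = {F. (\<lambda>i. w i * (F i)\<^sup>2) summable_on UNIV}"

definition wform :: "('i \<Rightarrow> real) \<Rightarrow> ('i \<Rightarrow> real) \<Rightarrow> ('i \<Rightarrow> real) \<Rightarrow> real" where
  "wform w F G = (\<Sum>\<^sub>\<infinity>i. w i * F i * G i)"

lemma wdom_scale: "F \<in> wdom w \<Longrightarrow> (\<lambda>i. r * F i) \<in> wdom w"
  using summable_on_cmult_right[of "\<lambda>i. w i * (F i)\<^sup>2" UNIV "r\<^sup>2"]
  by (simp add: wdom_def power_mult_distrib mult_ac)

lemma wform_sym: "wform w F G = wform w G F"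
  by (simp add: wform_def mult_ac)

lemma wform_scale: "wform w (\<lambda>i. r * F i) G = r * wform w F G"
  by (simp add: wform_def mult_ac flip: infsum_cmult_right')

context
  fixes w :: "'i \<Rightarrow> real"
  assumes w: "\<And>i. 0 \<le> w i"
begin

lemma wprod_summable:
  assumes "F \<in> wdom w" "G \<in> wdom w"
  shows "(\<lambda>i. w i * F i * G i) summable_on UNIV"
proof (rule abs_summable_summable, rule summable_on_comparison_test)
  show "(\<lambda>i. w i * (F i)\<^sup>2 + w i * (G i)\<^sup>2) summable_on UNIV"
    using assms by (intro summable_on_add) (auto simp: wdom_def)
  fix i
  have "\<bar>F i * G i\<bar> \<le> (F i)\<^sup>2 + (G i)\<^sup>2"
    using sum_squares_bound[of "\<bar>F i\<bar>" "\<bar>G i\<bar>"] mult_nonneg_nonneg[of "\<bar>F i\<bar>" "\<bar>G i\<bar>"]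
    unfolding abs_mult power2_abs mult.assoc by linarith
  then show "norm (w i * F i * G i) \<le> w i * (F i)\<^sup>2 + w i * (G i)\<^sup>2"
    using mult_left_mono[OF _ w] by (simp add: abs_mult w mult.assoc flip: distrib_left)
qed auto

lemma wdom_add:
  assumes "F \<in> wdom w" "G \<in> wdom w"
  shows "F + G \<in> wdom w"
proof -
  have "(\<lambda>i. w i * (F i)\<^sup>2 + w i * (G i)\<^sup>2 + 2 * (w i * F i * G i)) summable_on UNIV"
    using assms wprod_summable[OF assms]
    by (intro summable_on_add summable_on_cmult_right) (auto simp: wdom_def)
  then show ?thesis by (simp add: wdom_def power2_eq_square algebra_simps)
qed

lemma wdom_diff: "F \<in> wdom w \<Longrightarrow> G \<in> wdom w \<Longrightarrow> F - G \<in> wdom w"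
  using wdom_add[of F "\<lambda>i. - 1 * G i"] wdom_scale[of G w "- 1"]
  by (simp add: plus_fun_def fun_diff_def)

lemma wform_add:
  assumes "F \<in> wdom w" "G \<in> wdom w" "K \<in> wdom w"
  shows "wform w (F + G) K = wform w F K + wform w G K"
proof -
  have "wform w (F + G) K = (\<Sum>\<^sub>\<infinity>i. w i * F i * K i + w i * G i * K i)"
    by (simp add: wform_def algebra_simps)
  also have "\<dots> = wform w F K + wform w G K"
    unfolding wform_def by (intro infsum_add wprod_summable assms)
  finally show ?thesis .
qed

lemma wform_nonneg: "0 \<le> wform w F F"
  unfolding wform_def by (intro infsum_nonneg) (simp add: w mult.assoc)

lemma wform_ge_sum:
  assumes "F \<in> wdom w" "finite I"
  shows "(\<Sum>i\<in>I. w i * (F i)\<^sup>2) \<le> wform w F F"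
proof -
  have "(\<Sum>i\<in>I. w i * (F i)\<^sup>2) \<le> (\<Sum>\<^sub>\<infinity>i. w i * (F i)\<^sup>2)"
    using assms by (intro finite_sum_le_infsum) (auto simp: wdom_def w)
  then show ?thesis by (simp add: wform_def power2_eq_square mult.assoc)
qed

lemma wdomI_bounded:
  assumes "\<And>I. finite I \<Longrightarrow> (\<Sum>i\<in>I. w i * (F i)\<^sup>2) \<le> K"
  shows "F \<in> wdom w" "wform w F F \<le> K"
proof -
  show *: "F \<in> wdom w"
    unfolding wdom_def using assms
    by (auto intro!: nonneg_bdd_above_summable_on bdd_aboveI[of _ K] simp: w)
  then show "wform w F F \<le> K"
    unfolding wform_def using assms
    by (intro infsum_le_finite_sums) (auto simp: wdom_def power2_eq_square mult.assoc)
qed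

end

abbreviation (input) fscale :: "real \<Rightarrow> ('a \<Rightarrow> real) \<Rightarrow> 'a \<Rightarrow> real" where
  "fscale \<equiv> \<lambda>r f x. r * f x"

text \<open>The map \<open>T\<close> is the identity for sums over vertices and \<open>grad\<close>
  for the sum over edges.\<close>

lemma psd_form_wform:
  assumes w: "\<And>i. 0 \<le> w i" and D: "fun_space.subspace D"
    and T: "\<And>f. f \<in> D \<Longrightarrow> T f \<in> wdom w"
    and add: "\<And>f g. T (f + g) = T f + T g" and scale: "\<And>r f. T (fscale r f) = fscale r (T f)"
  shows "psd_form fscale D (\<lambda>f g. wform w (T f) (T g))"
  by unfold_locales
     (use D T in \<open>auto simp: add scale wform_add[OF w] wform_scale wform_nonneg[OF w]
        intro: wform_sym\<close>)

lemma psd_form_add: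
  assumes "psd_form s D B" "psd_form s D B'" and "0 \<le> (k::real)"
  shows "psd_form s D (\<lambda>f g. k * B f g + B' f g)"
proof -
  interpret B: psd_form s D B by fact
  interpret B': psd_form s D B' by fact
  show ?thesis
    by unfold_locales
       (use assms(3) in \<open>auto simp: B.sym B'.sym B.add_left B'.add_left B.scale_left B'.scale_left
          B.D_subspace B.nonneg B'.nonneg algebra_simps\<close>)
qed

definition grad :: "('a \<Rightarrow> real) \<Rightarrow> 'a \<times> 'a \<Rightarrow> real" where
  "grad f = (\<lambda>(x, y). f x - f y)"

lemma ell2_eq: "ell2 m = wdom m"
  by (simp add: ell2_def wdom_def mult.commute)

lemma ell2_inner_eq: "ell2_inner m = wform m"
  by (simp add: fun_eq_iff ell2_inner_def wform_def mult_ac)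

lemma finite_energy_eq: "finite_energy b c = {f. grad f \<in> wdom (case_prod b) \<and> f \<in> wdom c}"
  by (simp add: finite_energy_def wdom_def grad_def case_prod_unfold)

lemma energy_form_eq:
  "energy_form b c = (\<lambda>f g. 1/2 * wform (case_prod b) (grad f) (grad g) + wform c f g)"
  by (simp add: fun_eq_iff energy_form_def wform_def grad_def case_prod_unfold)

lemma energy_form_split: "energy_form b c f g = energy_form b (\<lambda>_. 0) f g + wform c f g"
  by (simp add: energy_form_eq wform_def)

lemma psd_form_energy:
  assumes "\<And>x y. 0 \<le> b x y" "\<And>x. 0 \<le> c x" "fun_space.subspace D" "D \<subseteq> finite_energy b c"
  shows "psd_form fscale D (energy_form b c)"
proof -
  have "psd_form fscale D (\<lambda>f g. wform (case_prod b) (grad f) (grad g))"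
    using assms
    by (intro psd_form_wform) (auto simp: finite_energy_eq grad_def fun_eq_iff algebra_simps)
  moreover have "psd_form fscale D (\<lambda>f g. wform c f g)"
    using assms by (intro psd_form_wform[where T = "\<lambda>f. f"]) (auto simp: finite_energy_eq)
  ultimately show ?thesis
    unfolding energy_form_eq by (intro psd_form_add) auto
qed

lemma psd_form_ell2_inner:
  assumes "\<And>x. 0 < m x" "fun_space.subspace D" "D \<subseteq> ell2 m"
  shows "psd_form fscale D (ell2_inner m)"
  unfolding ell2_inner_eq using assms
  by (intro psd_form_wform[where T = "\<lambda>f. f"]) (auto simp: ell2_eq less_imp_le)

lemma subspace_wdom: "(\<And>i. 0 \<le> w i) \<Longrightarrow> fun_space.subspace (wdom w)"
  by (rule fun_space.subspaceI) (auto simp: wdom_add wdom_scale, simp add: wdom_def)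

lemma ell2_norm_square: "(\<And>x. 0 < m x) \<Longrightarrow> (ell2_norm m f)\<^sup>2 = ell2_inner m f f"
  by (simp add: ell2_norm_def ell2_inner_eq wform_nonneg less_imp_le)

section \<open>Closedness and compact embedding of the induced form\<close>

lemma point_le_ell2_inner:
  assumes "\<And>x. 0 < m x" "f \<in> ell2 m"
  shows "m x * (f x)\<^sup>2 \<le> ell2_inner m f f"
  using wform_ge_sum[of m f "{x}"] assms by (simp add: ell2_eq ell2_inner_eq less_imp_le)

lemma induced_form_domain_eq:
  "DQ \<subseteq> ell2 m \<Longrightarrow> induced_form_domain m c DQ = DQ \<inter> wdom c"
  by (auto simp: induced_form_domain_def wdom_def)

text \<open>A Cauchy sequence for the larger form norm is Cauchy for the original one, so closedness
  yields a limit \<open>f\<close> in \<open>DQ\<close>. Convergence in \<open>ell2 m\<close> is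
  pointwise because \<open>m\<close> is positive, and this allows the killing term to be controlled
  in the limit.\<close>

lemma induced_complete:
  fixes b :: "'a \<Rightarrow> 'a \<Rightarrow> real" and c m :: "'a \<Rightarrow> real" and u :: "nat \<Rightarrow> 'a \<Rightarrow> real"
  assumes m: "\<And>x. 0 < m x" and b: "\<And>x y. 0 \<le> b x y" and c: "\<And>x. 0 \<le> c x"
    and DQ: "realization_form m b DQ"
    and u: "\<And>n. u n \<in> DQ \<inter> wdom c"
    and cauchy: "\<And>e. e > 0 \<Longrightarrow> \<exists>M. \<forall>i\<ge>M. \<forall>j\<ge>M.
      ell2_inner m (u i - u j) (u i - u j) + energy_form b c (u i - u j) (u i - u j) < e"
  shows "\<exists>f\<in>DQ \<inter> wdom c. (\<lambda>n. ell2_inner m (u n - f) (u n - f)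
      + energy_form b c (u n - f) (u n - f)) \<longlonglongrightarrow> 0"
proof -
  let ?Q = "energy_form b (\<lambda>_. 0)"
  define N0 where "N0 = (\<lambda>f. ell2_inner m f f + ?Q f f)"
  have sub: "fun_space.subspace DQ" and l2: "DQ \<subseteq> ell2 m"
    and compl: "complete_wrt (form_norm m ?Q) DQ"
    using DQ by (auto simp: realization_form_def)
  have Q0: "0 \<le> ?Q f f" for f
    using wform_nonneg[of "case_prod b" "grad f"] wform_nonneg[of "\<lambda>_. 0" f] b
    by (auto simp: energy_form_eq)
  have H0: "0 \<le> ell2_inner m f f" for f
    using m by (simp add: ell2_inner_eq wform_nonneg less_imp_le)
  have fn: "form_norm m ?Q f = sqrt (N0 f)" for f
    using m by (simp add: form_norm_def N0_def ell2_norm_square)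
  have N0: "0 \<le> N0 f" for f using Q0 H0 by (simp add: N0_def)
  have Nc: "ell2_inner m f f + energy_form b c f f = N0 f + wform c f f" for f
    by (simp add: N0_def energy_form_split[of b c])
  have small: "\<exists>M. \<forall>i\<ge>M. \<forall>j\<ge>M. N0 (u i - u j) + wform c (u i - u j) (u i - u j) < e"
    if "e > 0" for e using cauchy[OF that] unfolding Nc .
  have "\<exists>M. \<forall>i\<ge>M. \<forall>j\<ge>M. form_norm m ?Q (u i - u j) < e" if "e > 0" for e
  proof -
    obtain M where M: "\<And>i j. i \<ge> M \<Longrightarrow> j \<ge> M \<Longrightarrow>
        N0 (u i - u j) + wform c (u i - u j) (u i - u j) < e\<^sup>2"
      using small[of "e\<^sup>2"] \<open>e > 0\<close> by auto
    have "form_norm m ?Q (u i - u j) < e" if "i \<ge> M" "j \<ge> M" for i j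
      unfolding fn using M[OF that] wform_nonneg[of c "u i - u j"] c \<open>e > 0\<close>
      by (intro real_less_lsqrt) auto
    then show ?thesis by blast
  qed
  then obtain f where f: "f \<in> DQ" and "(\<lambda>n. form_norm m ?Q (u n - f)) \<longlonglongrightarrow> 0"
    using compl[unfolded complete_wrt_def, rule_format, of u] u by blast
  then have "(\<lambda>n. (form_norm m ?Q (u n - f))\<^sup>2) \<longlonglongrightarrow> 0"
    by (intro tendsto_null_power) auto
  then have lim0: "(\<lambda>n. N0 (u n - f)) \<longlonglongrightarrow> 0"
    unfolding fn using N0 by simp
  have pointwise: "(\<lambda>n. u n x) \<longlonglongrightarrow> f x" for x
  proof -
    have "u n - f \<in> ell2 m" for n
      using u[of n] f l2 fun_space.subspace_diff[OF sub] by blast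
    then have "m x * (u n x - f x)\<^sup>2 \<le> N0 (u n - f)" for n
      using point_le_ell2_inner[of m "u n - f" x] m Q0[of "u n - f"] by (simp add: N0_def add_increasing2)
    then have "(\<lambda>n. m x * (u n x - f x)\<^sup>2) \<longlonglongrightarrow> 0"
      using m[of x]
      by (intro tendsto_sandwich[OF _ _ tendsto_const lim0]) (auto intro!: always_eventually simp: less_imp_le)
    then have "(\<lambda>n. 1 / m x * (m x * (u n x - f x)\<^sup>2)) \<longlonglongrightarrow> 1 / m x * 0"
      by (intro tendsto_intros)
    then have "(\<lambda>n. (u n x - f x)\<^sup>2) \<longlonglongrightarrow> 0"
      using m[of x] by simp
    then show ?thesis by (simp add: LIM_zero_iff)
  qed
  \<comment> \<open>Fatou's lemma for the killing term.\<close>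
  have fatou: "\<exists>M. \<forall>n\<ge>M. u n - f \<in> wdom c \<and> wform c (u n - f) (u n - f) \<le> e" if "e > 0" for e
  proof -
    obtain M where M: "\<And>i j. i \<ge> M \<Longrightarrow> j \<ge> M \<Longrightarrow>
        N0 (u i - u j) + wform c (u i - u j) (u i - u j) < e"
      using small[of e] \<open>e > 0\<close> by blast
    have "(\<Sum>x\<in>I. c x * ((u n - f) x)\<^sup>2) \<le> e" if I: "finite I" and n: "n \<ge> M" for n I
    proof (rule tendsto_upperbound)
      show "(\<lambda>k. \<Sum>x\<in>I. c x * ((u n - u k) x)\<^sup>2) \<longlonglongrightarrow> (\<Sum>x\<in>I. c x * ((u n - f) x)\<^sup>2)"
        by (auto intro!: tendsto_intros pointwise)
      have "(\<Sum>x\<in>I. c x * ((u n - u k) x)\<^sup>2) \<le> e" if "k \<ge> M" for k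
        using wform_ge_sum[of c "u n - u k", OF _ _ I] wdom_diff[of c "u n" "u k"] c u
          M[OF n that] N0[of "u n - u k"] by simp
      then show "\<forall>\<^sub>F k in sequentially. (\<Sum>x\<in>I. c x * ((u n - u k) x)\<^sup>2) \<le> e"
        by (rule eventually_sequentiallyI)
    qed simp
    then have "u n - f \<in> wdom c \<and> wform c (u n - f) (u n - f) \<le> e" if "n \<ge> M" for n
      using wdomI_bounded[of c "u n - f" e] c that by blast
    then show ?thesis by blast
  qed
  obtain n where "u n - f \<in> wdom c" using fatou[of 1] by auto
  then have "u n - (u n - f) \<in> wdom c" using wdom_diff[of c "u n" "u n - f"] c u by blast
  then have fc: "f \<in> wdom c" by simp
  have "(\<lambda>n. wform c (u n - f) (u n - f)) \<longlonglongrightarrow> 0"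
  proof (rule LIMSEQ_I)
    fix e :: real assume "e > 0"
    then obtain M where "\<forall>n\<ge>M. wform c (u n - f) (u n - f) \<le> e / 2" using fatou[of "e/2"] by auto
    then show "\<exists>M. \<forall>n\<ge>M. norm (wform c (u n - f) (u n - f) - 0) < e"
      using wform_nonneg[of c] c \<open>e > 0\<close> by (intro exI[of _ M]) (fastforce simp: abs_of_nonneg)
  qed
  then have "(\<lambda>n. N0 (u n - f) + wform c (u n - f) (u n - f)) \<longlonglongrightarrow> 0"
    using tendsto_add[OF lim0] by fastforce
  then show ?thesis unfolding Nc using f fc by blast
qed

text \<open>Compactness is inherited because adding the killing term only enlarges the form norm.
  The choice \<open>c = 0\<close> recovers the original form.\<close>

lemma discrete_form_induced:
  fixes b :: "'a \<Rightarrow> 'a \<Rightarrow> real" and c m :: "'a \<Rightarrow> real"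
  assumes m: "\<And>x. 0 < m x" and b: "\<And>x y. 0 \<le> b x y" and c: "\<And>x. 0 \<le> c x"
    and DQ: "realization_form m b DQ"
    and cpt: "compactly_embedded m (energy_form b (\<lambda>_. 0)) DQ"
  shows "discrete_form fscale (DQ \<inter> wdom c) (ell2_inner m) (energy_form b c)"
proof -
  have sub: "fun_space.subspace DQ" and l2: "DQ \<subseteq> ell2 m" and fe: "DQ \<subseteq> finite_energy b (\<lambda>_. 0)"
    using DQ by (auto simp: realization_form_def)
  have subc: "fun_space.subspace (DQ \<inter> wdom c)"
    by (intro fun_space.subspace_inter sub subspace_wdom c)
  interpret H: psd_form fscale "DQ \<inter> wdom c" "ell2_inner m"
    using l2 by (intro psd_form_ell2_inner m subc) auto
  interpret Q: psd_form fscale "DQ \<inter> wdom c" "energy_form b c"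
    using fe by (intro psd_form_energy b c subc) (auto simp: finite_energy_eq)
  \<comment> \<open>Compact embedding provides a limit that is only known to lie in
    \<open>ell2 m\<close>, so the parallelogram law is applied on this whole space.\<close>
  interpret E: psd_form fscale "ell2 m" "ell2_inner m"
    using m by (intro psd_form_ell2_inner) (auto simp: ell2_eq less_imp_le intro: subspace_wdom)
  show ?thesis
  proof unfold_locales
    fix f assume f: "f \<in> DQ \<inter> wdom c" "ell2_inner m f f = 0"
    have "f x = 0" for x
    proof -
      have "m x * (f x)\<^sup>2 \<le> 0" using point_le_ell2_inner[of m f x] m f l2 by auto
      then show ?thesis using m[of x] by (simp add: mult_le_0_iff)
    qed
    then show "f = 0" by (simp add: fun_eq_iff)
  next
    fix u :: "nat \<Rightarrow> 'a \<Rightarrow> real"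
    assume "\<And>n. u n \<in> DQ \<inter> wdom c" "\<And>e. e > 0 \<Longrightarrow> \<exists>M. \<forall>i\<ge>M. \<forall>j\<ge>M.
      ell2_inner m (u i - u j) (u i - u j) + energy_form b c (u i - u j) (u i - u j) < e"
    then show "\<exists>f\<in>DQ \<inter> wdom c. (\<lambda>n. ell2_inner m (u n - f) (u n - f)
        + energy_form b c (u n - f) (u n - f)) \<longlonglongrightarrow> 0"
      using m b c DQ by (rule induced_complete[rotated 4])
  next
    fix u :: "nat \<Rightarrow> 'a \<Rightarrow> real" and K
    assume u: "\<And>n. u n \<in> DQ \<inter> wdom c"
      and K: "\<And>n. ell2_inner m (u n) (u n) + energy_form b c (u n) (u n) \<le> K"
    have "form_norm m (energy_form b (\<lambda>_. 0)) (u n) \<le> sqrt K" for n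
      using K[of n] wform_nonneg[of c "u n"] c
      by (simp add: form_norm_def ell2_norm_square m energy_form_split[of b c])
    then obtain r f where r: "strict_mono (r :: nat \<Rightarrow> nat)" and f: "f \<in> ell2 m"
      and "(\<lambda>n. ell2_norm m (u (r n) - f)) \<longlonglongrightarrow> 0"
      using cpt[unfolded compactly_embedded_def, rule_format, of u] u by blast
    then have "(\<lambda>n. (ell2_norm m (u (r n) - f))\<^sup>2) \<longlonglongrightarrow> 0"
      by (intro tendsto_null_power) auto
    then have lim: "(\<lambda>n. ell2_inner m (u (r n) - f) (u (r n) - f)) \<longlonglongrightarrow> 0"
      by (simp add: ell2_norm_square m)
    have "\<exists>M. \<forall>i\<ge>M. \<forall>j\<ge>M. ell2_inner m (u (r i) - u (r j)) (u (r i) - u (r j)) < e"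
      if "e > 0" for e
    proof -
      obtain M where M: "\<And>i. i \<ge> M \<Longrightarrow> \<bar>ell2_inner m (u (r i) - f) (u (r i) - f)\<bar> < e / 4"
        using LIMSEQ_D[OF lim, of "e / 4"] \<open>e > 0\<close> by auto
      have "ell2_inner m (u (r i) - u (r j)) (u (r i) - u (r j)) < e" if "i \<ge> M" "j \<ge> M" for i j
      proof -
        let ?p = "u (r i) - f" and ?q = "u (r j) - f"
        have D: "?p \<in> ell2 m" "?q \<in> ell2 m" using u l2 f by (auto intro!: E.D_closed)
        have "ell2_inner m (?p - ?q) (?p - ?q) \<le> 2 * ell2_inner m ?p ?p + 2 * ell2_inner m ?q ?q"
          using E.parallelogram[OF D] E.nonneg[OF E.D_closed(2)[OF D]] by simp
        then show ?thesis using M[OF that(1)] M[OF that(2)] by simp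
      qed
      then show ?thesis by blast
    qed
    then show "\<exists>r::nat \<Rightarrow> nat. strict_mono r \<and> (\<forall>e>0. \<exists>M. \<forall>i\<ge>M. \<forall>j\<ge>M.
        ell2_inner m (u (r i) - u (r j)) (u (r i) - u (r j)) < e)"
      using r by blast
  qed
qed

section \<open>Eigenvalues of the associated operators\<close>

lemma edim_mono_infinite: "V \<subseteq> W \<Longrightarrow> edim V = \<infinity> \<Longrightarrow> edim W = \<infinity>"
  unfolding edim_def by (auto split: if_splits)

definition point_mass :: "'a \<Rightarrow> 'a \<Rightarrow> real" where
  "point_mass x = (\<lambda>y. if y = x then 1 else 0)"

lemma sum_fun_at: "(\<Sum>i\<in>I. F i) x = (\<Sum>i\<in>I. (F i x :: real))"
  by (induction I rule: infinite_finite_induct) auto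

lemma independent_point_mass: "fun_space.independent (range point_mass)"
proof
  assume "fun_space.dependent (range (point_mass :: 'a \<Rightarrow> 'a \<Rightarrow> real))"
  then obtain T u v where T: "finite T" "T \<subseteq> range point_mass" "v \<in> T" "u v \<noteq> 0"
    and sum: "(\<Sum>v\<in>T. fscale (u v) v) = (0 :: 'a \<Rightarrow> real)"
    unfolding fun_space.dependent_explicit by blast
  obtain y where y: "v = point_mass y" using T by auto
  have vy: "v y = 1" by (simp add: y point_mass_def)
  have eq: "w = v" if "w \<in> T" "w y \<noteq> 0" for w
  proof -
    have "w \<in> range point_mass" using T(2) that(1) by blast
    then obtain z where "w = point_mass z" by blast
    then show ?thesis using that(2) y by (simp add: point_mass_def split: if_splits)
  qed
  have "0 = (\<Sum>v\<in>T. fscale (u v) v) y" using sum by simp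
  also have "\<dots> = (\<Sum>w\<in>T. u w * w y)" by (simp add: sum_fun_at)
  also have "\<dots> = (\<Sum>w\<in>T. if v = w then u v else 0)"
    by (intro sum.cong refl) (use eq vy in auto)
  finally show False using T by simp
qed

lemma inj_point_mass: "inj point_mass"
  by (rule injI) (metis point_mass_def zero_neq_one)

lemma finitely_supported_point_mass: "point_mass x \<in> finitely_supported"
  by (simp add: finitely_supported_def point_mass_def)

lemma edim_infinite:
  assumes "infinite (UNIV :: 'a set)" "finitely_supported \<subseteq> (V :: ('a \<Rightarrow> real) set)"
  shows "edim V = \<infinity>"
proof -
  have False if "finite B" "V \<subseteq> fun_space.span B" for B
  proof -
    have "finitely_supported \<subseteq> fun_space.span B" using assms(2) that(2) by (rule order_trans)
    then have "range point_mass \<subseteq> fun_space.span B"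
      using finitely_supported_point_mass by (intro image_subsetI) (rule subsetD)
    then have "finite (range (point_mass :: 'a \<Rightarrow> 'a \<Rightarrow> real))"
      using fun_space.independent_span_bound[OF that(1) independent_point_mass] by simp
    then have "finite (UNIV :: 'a set)" by (rule finite_imageD[OF _ inj_point_mass])
    then show False using assms(1) by simp
  qed
  then show ?thesis by (auto simp: edim_def)
qed

lemma edim_finite:
  assumes "finite (UNIV :: 'a set)"
  shows "edim (V :: ('a \<Rightarrow> real) set) \<noteq> \<infinity>"
proof -
  have "f \<in> fun_space.span (range point_mass)" for f :: "'a \<Rightarrow> real"
  proof -
    have "f = (\<Sum>x\<in>UNIV. fscale (f x) (point_mass x))"
    proof
      fix y
      have "(\<Sum>x\<in>UNIV. fscale (f x) (point_mass x)) y = (\<Sum>x\<in>UNIV. if y = x then f y else 0)"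
        unfolding sum_fun_at by (intro sum.cong) (auto simp: point_mass_def)
      then show "f y = (\<Sum>x\<in>UNIV. fscale (f x) (point_mass x)) y" using assms by simp
    qed
    also have "\<dots> \<in> fun_space.span (range point_mass)"
      by (intro fun_space.span_sum fun_space.span_scale fun_space.span_base) auto
    finally show ?thesis .
  qed
  then have "\<exists>B. finite B \<and> V \<subseteq> fun_space.span B"
    using assms by (intro exI[of _ "range point_mass"]) auto
  then show ?thesis by (simp add: edim_def)
qed

lemma edim_span_independent:
  assumes "finite B" "fun_space.independent B"
  shows "edim (fun_space.span B) = enat (card B)"
  using assms by (auto simp: edim_def fun_space.dim_eq_card_independent)

text \<open>At the first disagreement let \<open>p n < q n\<close>. Monotonicity confines the level
  set of \<open>q\<close> at the value \<open>p n\<close> to indices before \<open>n\<close>, where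
  \<open>p\<close> and \<open>q\<close> agree. It is therefore contained in the corresponding level
  set of \<open>p\<close> without \<open>n\<close>, and finite cardinalities cannot match.\<close>

lemma mono_on_levels_unique:
  fixes f g :: "nat \<Rightarrow> real"
  assumes mono: "mono_on I f" "mono_on I g"
    and levels: "\<And>t. ecard {n \<in> I. f n = t} = ecard {n \<in> I. g n = t}"
    and fin: "\<And>t. finite {n \<in> I. f n = t}"
    and n: "n \<in> I"
  shows "f n = g n"
  using n
proof (induction n rule: less_induct)
  case (less n)
  have fin': "finite {n \<in> I. g n = t}" for t
    using levels[of t] fin[of t] by (auto simp: ecard_def split: if_splits)
  have card: "card {n \<in> I. f n = t} = card {n \<in> I. g n = t}" for t
    using levels[of t] fin[of t] fin'[of t] by (simp add: ecard_def)
  have False if lt: "p n < q n" and mono_q: "mono_on I q"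
    and pq: "\<And>k. k < n \<Longrightarrow> k \<in> I \<Longrightarrow> p k = q k"
    and fin_p: "finite {k \<in> I. p k = p n}"
    and card_pq: "card {k \<in> I. p k = p n} = card {k \<in> I. q k = p n}" for p q :: "nat \<Rightarrow> real"
  proof -
    have "k < n" if "k \<in> I" "q k = p n" for k
      using mono_onD[OF mono_q less.prems that(1)] lt that(2) by force
    then have "{k \<in> I. q k = p n} \<subseteq> {k \<in> I. p k = p n} - {n}" using pq by auto
    then have "card {k \<in> I. q k = p n} \<le> card ({k \<in> I. p k = p n} - {n})"
      using fin_p by (intro card_mono) auto
    also have "\<dots> < card {k \<in> I. p k = p n}"
      using fin_p less.prems by (intro card_Diff1_less) auto
    finally show False using card_pq by simp
  qed
  from this[of f g] this[of g f] show ?case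
    using mono less.IH fin fin' card by (metis linorder_neqE_linordered_idom)
qed

context discrete_form
begin

lemma subset_span_ev: "J = {..<N} \<Longrightarrow> D \<subseteq> H.span (ev ` J)"
proof
  fix w assume J: "J = {..<N}" and w: "w \<in> D"
  then have "w = proj {..<N} w" by (intro not_in_J) auto
  also have "\<dots> \<in> H.span (ev ` J)"
    unfolding proj_def J by (intro H.span_sum H.span_scale H.span_base) auto
  finally show "w \<in> H.span (ev ` J)" .
qed

lemma J_bounded:
  assumes "finite F" "F \<subseteq> J"
  obtains N where "{..<N} \<subseteq> J" "F \<subseteq> {..<N}"
proof (cases "F = {}")
  case False
  then have "Max F \<in> J" using assms Max_in by blast
  then have "{..<Suc (Max F)} \<subseteq> J" using J_downward by (auto simp: less_Suc_eq_le)
  moreover have "F \<subseteq> {..<Suc (Max F)}" using assms by (auto simp: less_Suc_eq_le)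
  ultimately show ?thesis by (rule that)
qed (use that[of 0] in auto)

end

section \<open>Identification of the minimal values with the listed eigenvalues\<close>

locale ell2_discrete_form =
  discrete_form fscale D "ell2_inner m" Q for D :: "('a \<Rightarrow> real) set" and m Q +
  assumes m_pos: "0 < m x"
    and D_ell2: "D \<subseteq> ell2 m"
    and finitely_supported_D: "finitely_supported \<subseteq> D"
begin

lemma edim_D: "edim D = ecard J"
proof (cases rule: J_cases)
  case 1
  have False if "finite B" "D \<subseteq> fun_space.span B" for B
  proof -
    have "ev ` J \<subseteq> fun_space.span B" using that(2) ev_in by blast
    then have "finite (ev ` J)"
      using fun_space.independent_span_bound[OF that(1) independent_ev[OF order_refl]] by simp
    then show False using finite_imageD[OF _ inj_on_ev] 1 by simp
  qed
  then show ?thesis using 1 by (auto simp: edim_def ecard_def)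
next
  case (2 N)
  have sp: "D \<subseteq> fun_space.span (ev ` J)" by (rule subset_span_ev[OF 2])
  have "fun_space.dim D = card (ev ` J)"
    using fun_space.basis_card_eq_dim[OF _ sp independent_ev[OF order_refl]] ev_in by (metis image_subsetI)
  moreover have "card (ev ` J) = card J" by (rule card_image[OF inj_on_ev])
  moreover have "finite (ev ` J)" using 2 by simp
  ultimately show ?thesis using sp 2 unfolding edim_def ecard_def by auto
qed

text \<open>The minimizers live in the form domain, whereas eigenvalues are indexed by the dimension
  of the whole space. For finite \<open>X\<close> the two spaces coincide; for infinite
  \<open>X\<close> the point masses make both dimensions infinite.\<close>

lemma edim_ell2: "edim (ell2 m) = ecard J"
proof (cases "finite (UNIV :: 'a set)")
  case True
  have "D = UNIV" using finitely_supported_D True finite_subset[OF subset_UNIV True]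
    by (auto simp: finitely_supported_def)
  then have "D = ell2 m" using D_ell2 by auto
  then show ?thesis using edim_D by simp
next
  case False
  then have "edim D = \<infinity>" by (rule edim_infinite[OF _ finitely_supported_D])
  then show ?thesis using edim_mono_infinite[OF D_ell2] edim_D by simp
qed

lemma finite_J_iff: "finite J \<longleftrightarrow> finite (UNIV :: 'a set)"
  using edim_finite[of D] edim_infinite[OF _ finitely_supported_D]
  unfolding edim_D ecard_def by (metis enat.distinct(1))

lemma eigenvalue_indices_eq: "eigenvalue_indices m = Suc ` J"
proof (cases rule: J_cases)
  case 1
  have "n \<in> range Suc" if "1 \<le> n" for n using that by (cases n) auto
  then show ?thesis unfolding eigenvalue_indices_def edim_ell2 1 by (auto simp: ecard_def)
next
  case (2 N)
  then show ?thesis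
    unfolding eigenvalue_indices_def edim_ell2 2 image_Suc_lessThan by (auto simp: ecard_def)
qed

text \<open>Self-adjointness promotes weak eigenvectors to eigenvectors of the operator.\<close>

lemma eigenspace_eq:
  assumes "associated_operator m Q D DL L"
  shows "eigenspace DL L t = fun_space.span (ev ` {n \<in> J. lam n = t})"
proof -
  have DL: "DL \<subseteq> D" and Q: "\<And>f g. f \<in> D \<Longrightarrow> g \<in> DL \<Longrightarrow> Q f g = ell2_inner m f (L g)"
    and graph: "operator_graph DL L = adjoint_graph m DL L"
    using assms by (auto simp: associated_operator_def self_adjoint_operator_def)
  have scale: "ell2_inner m g (fscale t f) = t * ell2_inner m g f" for g f
    by (simp add: ell2_inner_eq wform_sym[of m g] wform_scale)
  have sym: "ell2_inner m f g = ell2_inner m g f" for f g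
    by (simp add: ell2_inner_eq wform_sym)
  have "eigenspace DL L t = {f \<in> D. \<forall>g\<in>D. Q g f = t * ell2_inner m g f}"
  proof (intro equalityI subsetI)
    fix f assume "f \<in> eigenspace DL L t"
    then show "f \<in> {f \<in> D. \<forall>g\<in>D. Q g f = t * ell2_inner m g f}"
      using DL Q scale by (auto simp: eigenspace_def)
  next
    fix f assume "f \<in> {f \<in> D. \<forall>g\<in>D. Q g f = t * ell2_inner m g f}"
    then have f: "f \<in> D" and weak: "\<And>g. g \<in> D \<Longrightarrow> Q g f = t * ell2_inner m g f" by auto
    have "ell2_inner m (L g) f = ell2_inner m g (fscale t f)" if g: "g \<in> DL" for g
    proof -
      have gD: "g \<in> D" using g DL by blast
      have "ell2_inner m (L g) f = Q f g" using Q[OF f g] sym by metis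
      also have "\<dots> = Q g f" by (rule Q.sym[OF f gD])
      finally show ?thesis using weak[OF gD] scale by simp
    qed
    moreover have "fscale t f \<in> ell2 m" using D_ell2 H.D_closed(4)[OF f] by blast
    ultimately have "(f, fscale t f) \<in> adjoint_graph m DL L"
      using f D_ell2 by (auto simp: adjoint_graph_def)
    then have "(f, fscale t f) \<in> operator_graph DL L" using graph by simp
    then show "f \<in> eigenspace DL L t" by (auto simp: operator_graph_def eigenspace_def)
  qed
  then show ?thesis by (simp add: weak_eigenspace)
qed

text \<open>Since \<open>eigenvalue\<close> is defined by choice, two facts are combined: the
  shifted \<open>lam\<close> is a listing, and listings with finite multiplicities agree on the
  index set.\<close>

lemma eigenvalue_eq:
  assumes L: "associated_operator m Q D DL L" and n: "n \<in> J"
  shows "eigenvalue m DL L (Suc n) = lam n"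
proof -
  \<comment> \<open>Eigenvalues are counted from one and minimizers from zero; the truncated value
    at \<open>0\<close> lies outside the index set.\<close>
  let ?l = "\<lambda>n. lam (n - 1)"
  have level: "{n \<in> eigenvalue_indices m. ?l n = t} = Suc ` {n \<in> J. lam n = t}" for t
    by (auto simp: eigenvalue_indices_eq)
  have fin: "finite {n \<in> J. lam n = t}" for t
    by (rule finite_subset[OF _ finite_lam_le[of t]]) auto
  have "eigenvalue_listing m DL L ?l"
    unfolding eigenvalue_listing_def
  proof (intro conjI allI)
    show "mono_on (eigenvalue_indices m) ?l"
      by (rule mono_onI) (auto simp: eigenvalue_indices_eq intro: lam_mono)
    fix t
    have "inj_on ev {n \<in> J. lam n = t}" using inj_on_ev by (rule inj_on_subset) auto
    then have "edim (eigenspace DL L t) = enat (card {n \<in> J. lam n = t})"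
      unfolding eigenspace_eq[OF L]
      using fin by (subst edim_span_independent) (auto simp: card_image intro!: independent_ev)
    then show "ecard {n \<in> eigenvalue_indices m. ?l n = t} = edim (eigenspace DL L t)"
      unfolding level using fin by (simp add: ecard_def card_image)
  qed
  note l = this
  have e: "eigenvalue_listing m DL L (eigenvalue m DL L)"
    unfolding eigenvalue_def by (rule someI[of "eigenvalue_listing m DL L", OF l])
  have "?l (Suc n) = eigenvalue m DL L (Suc n)"
  proof (rule mono_on_levels_unique)
    show "mono_on (eigenvalue_indices m) ?l" "mono_on (eigenvalue_indices m) (eigenvalue m DL L)"
      using l e by (auto simp: eigenvalue_listing_def)
    show "ecard {n \<in> eigenvalue_indices m. ?l n = t}
        = ecard {n \<in> eigenvalue_indices m. eigenvalue m DL L n = t}" for t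
      using l e by (simp add: eigenvalue_listing_def)
    show "finite {n \<in> eigenvalue_indices m. ?l n = t}" for t
      unfolding level using fin by simp
    show "Suc n \<in> eigenvalue_indices m" using n by (simp add: eigenvalue_indices_eq)
  qed
  then show ?thesis by simp
qed

section \<open>Point evaluations of the eigenvectors\<close>

lemma inner_point_mass: "ell2_inner m (point_mass x) f = f x * m x"
proof -
  have "ell2_inner m (point_mass x) f = (\<Sum>\<^sub>\<infinity>y\<in>{x}. point_mass x y * f y * m y)"
    unfolding ell2_inner_def by (rule infsum_cong_neutral) (auto simp: point_mass_def)
  then show ?thesis by (simp add: point_mass_def)
qed

lemma point_mass_D: "point_mass x \<in> D"
  by (rule subsetD[OF finitely_supported_D finitely_supported_point_mass])

text \<open>Bessel's inequality for the point mass at \<open>x\<close>: its coefficients are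
  \<open>ev n x * m x\<close> and its squared norm is \<open>m x\<close>.\<close>

lemma sum_ev_square_le:
  assumes "{..<N} \<subseteq> J"
  shows "(\<Sum>n<N. (ev n x)\<^sup>2) \<le> 1 / m x"
proof -
  have "(\<Sum>n<N. (ev n x)\<^sup>2) * (m x)\<^sup>2 \<le> m x"
    using bessel[of "{..<N}" "point_mass x"] assms point_mass_D
    by (simp add: inner_point_mass power_mult_distrib sum_distrib_right) (simp add: point_mass_def)
  then have "(\<Sum>n<N. (ev n x)\<^sup>2) * m x * m x \<le> 1 * m x"
    unfolding power2_eq_square mult.assoc by simp
  then have "(\<Sum>n<N. (ev n x)\<^sup>2) * m x \<le> 1"
    using m_pos[of x] by (rule mult_right_le_imp_le)
  then show ?thesis using m_pos[of x] by (simp add: pos_le_divide_eq)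
qed

text \<open>Parseval's identity for the point masses, with error \<open>(1 - z) * m x\<close>. The
  finitely many points of \<open>G\<close> share one \<open>N\<close>, because the sums increase
  with \<open>N\<close>.\<close>

lemma sum_ev_square_ge:
  assumes G: "finite G" and z: "z < 1"
  shows "\<exists>N. {..<N} \<subseteq> J \<and> (\<forall>x\<in>G. z / m x \<le> (\<Sum>n<N. (ev n x)\<^sup>2))"
proof -
  have "\<exists>N. {..<N} \<subseteq> J \<and> z / m x \<le> (\<Sum>n<N. (ev n x)\<^sup>2)" for x
  proof -
    have "(1 - z) * m x > 0" using z m_pos[of x] by simp
    from parseval[OF point_mass_D this, of x] obtain N where N: "{..<N} \<subseteq> J"
      and "m x - (1 - z) * m x < (\<Sum>n<N. (ev n x * m x)\<^sup>2)"
      by (auto simp: inner_point_mass) (auto simp: point_mass_def)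
    then have "z * m x \<le> (\<Sum>n<N. (ev n x)\<^sup>2) * (m x)\<^sup>2"
      by (simp add: power_mult_distrib sum_distrib_right left_diff_distrib)
    then have "z * m x \<le> (\<Sum>n<N. (ev n x)\<^sup>2) * m x * m x"
      unfolding power2_eq_square mult.assoc .
    then have "z \<le> (\<Sum>n<N. (ev n x)\<^sup>2) * m x"
      using m_pos[of x] by (rule mult_right_le_imp_le)
    then have "z / m x \<le> (\<Sum>n<N. (ev n x)\<^sup>2)"
      using m_pos[of x] by (simp add: pos_divide_le_eq)
    then show ?thesis using N by blast
  qed
  then obtain N where N: "\<And>x. {..<N x} \<subseteq> J" "\<And>x. z / m x \<le> (\<Sum>n<N x. (ev n x)\<^sup>2)"
    by metis
  \<comment> \<open>The inserted \<open>0\<close> covers an empty \<open>G\<close>.\<close>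
  define M where "M = Max (insert 0 (N ` G))"
  have "M = 0 \<or> (\<exists>x. M = N x)" using Max_in[of "insert 0 (N ` G)"] G by (auto simp: M_def)
  then have "{..<M} \<subseteq> J" using N(1) by auto
  moreover have "z / m x \<le> (\<Sum>n<M. (ev n x)\<^sup>2)" if "x \<in> G" for x
  proof -
    have "N x \<le> M" unfolding M_def using G that by (intro Max_ge) auto
    then have "(\<Sum>n<N x. (ev n x)\<^sup>2) \<le> (\<Sum>n<M. (ev n x)\<^sup>2)" by (intro sum_mono2) auto
    then show ?thesis using N(2)[of x] by simp
  qed
  ultimately show ?thesis by blast
qed

end

text \<open>Describing the right-hand side by finite sums lets the lower bound treat summable and
  divergent \<open>c x / m x\<close> together.\<close>

lemma ell1_sum_or_infinity_eq_SUP: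
  fixes f :: "'a \<Rightarrow> real"
  assumes "\<And>x. 0 \<le> f x"
  shows "ell1_sum_or_infinity f = (SUP G\<in>{G. finite G}. ereal (sum f G))"
proof (cases "f summable_on UNIV")
  case True
  then show ?thesis
    using infsum_nonneg_is_SUPREMUM_ereal[OF True] assms by (simp add: ell1_sum_or_infinity_def)
next
  case False
  have "(SUP G\<in>{G. finite G}. ereal (sum f G)) = \<infinity>"
  proof (rule SUP_PInfty)
    fix n :: nat
    have "\<exists>G. finite G \<and> real n \<le> sum f G"
    proof (rule ccontr)
      assume "\<not> ?thesis"
      then have "bdd_above (sum f ` {F. F \<subseteq> UNIV \<and> finite F})"
        by (intro bdd_aboveI[of _ "real n"]) (auto simp: not_le less_imp_le)
      then show False using nonneg_bdd_above_summable_on[of UNIV f] assms False by blast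
    qed
    then show "\<exists>G\<in>{G. finite G}. ereal (real n) \<le> ereal (sum f G)" by auto
  qed
  then show ?thesis using False assms by (simp add: ell1_sum_or_infinity_def)
qed

section \<open>The trace formula\<close>

lemma has_sum_finite_sum:
  fixes f :: "'i \<Rightarrow> 'x \<Rightarrow> real"
  assumes "\<And>i. i \<in> I \<Longrightarrow> (f i has_sum s i) A"
  shows "((\<lambda>x. \<Sum>i\<in>I. f i x) has_sum (\<Sum>i\<in>I. s i)) A"
  using assms
  by (induction I rule: infinite_finite_induct) (auto intro!: has_sum_add)

text \<open>This removes the factor \<open>z\<close> that the approximate Parseval identity leaves.
  The instance \<open>z = 0\<close> excludes \<open>T = -\<infinity>\<close>.\<close>

lemma ereal_le_mult_one_interval:
  assumes "\<And>z. z < 1 \<Longrightarrow> ereal (z * C) \<le> T"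
  shows "ereal C \<le> T"
proof (cases T)
  case (real t)
  then have "z * C \<le> t" if "z < 1" for z using assms[OF that] by simp
  then have "C \<le> t" by - (rule field_le_mult_one_interval, simp)
  then show ?thesis using real by simp
qed (use assms[of 0] in auto)

lemma ell2_discrete_form_induced:
  fixes b :: "'a \<Rightarrow> 'a \<Rightarrow> real" and c m :: "'a \<Rightarrow> real"
  assumes "\<And>x. 0 < m x" "\<And>x y. 0 \<le> b x y" "\<And>x. 0 \<le> c x"
    and DQ: "realization_form m b DQ"
    and "compactly_embedded m (energy_form b (\<lambda>_. 0)) DQ"
  shows "ell2_discrete_form (DQ \<inter> wdom c) m (energy_form b c)"
proof -
  interpret discrete_form fscale "DQ \<inter> wdom c" "ell2_inner m" "energy_form b c"
    using assms by (rule discrete_form_induced)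
  have "(\<lambda>x. c x * (f x)\<^sup>2) summable_on UNIV" if "f \<in> finitely_supported" for f
  proof -
    have "(\<lambda>x. c x * (f x)\<^sup>2) summable_on UNIV \<longleftrightarrow> (\<lambda>x. c x * (f x)\<^sup>2) summable_on {x. f x \<noteq> 0}"
      by (rule summable_on_cong_neutral) auto
    then show ?thesis using that by (simp add: finitely_supported_def)
  qed
  then show ?thesis
    by unfold_locales (use DQ assms(1) in \<open>auto simp: realization_form_def wdom_def\<close>)
qed

theorem theorem5:
  fixes b :: "'a::countable \<Rightarrow> 'a \<Rightarrow> real"
    and c m :: "'a \<Rightarrow> real"
    and DQ0 DL0 DLc :: "('a \<Rightarrow> real) set"
    and L0 Lc :: "('a \<Rightarrow> real) \<Rightarrow> ('a \<Rightarrow> real)"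
  assumes "\<And>x. m x > 0"
    and "weighted_graph b (\<lambda>_. 0)"
    and "realization m b DQ0 DL0 L0"
    and "compactly_embedded m (energy_form b (\<lambda>_. 0)) DQ0"
    and "\<And>x. c x \<ge> 0"
    and "induced_realization m b c DQ0 DLc Lc"
  shows "((\<lambda>n. ereal (eigenvalue m DLc Lc n - eigenvalue m DL0 L0 n))
            has_sum ell1_sum_or_infinity (\<lambda>x. c x / m x)) (eigenvalue_indices m)
         \<and> (finite (eigenvalue_indices m) \<longleftrightarrow> finite (UNIV :: 'a set))"
proof
  note m = assms(1) and c = assms(5)
  let ?Q0 = "energy_form b (\<lambda>_. 0)" and ?Qc = "energy_form b c" and ?Dc = "DQ0 \<inter> wdom c"
  have b: "0 \<le> b x y" for x y using assms(2) by (simp add: weighted_graph_def)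
  have DQ: "realization_form m b DQ0" using assms(3) by (simp add: realization_def)
  then have l2: "DQ0 \<subseteq> ell2 m" by (simp add: realization_form_def)
  \<comment> \<open>The original form is treated as the induced form of the zero potential.\<close>
  have "DQ0 \<inter> wdom (\<lambda>_. 0) = DQ0" by (auto simp: wdom_def)
  then interpret A: ell2_discrete_form DQ0 m ?Q0
    using ell2_discrete_form_induced[of m b "\<lambda>_. 0" DQ0] m b DQ assms(4) by simp
  interpret B: ell2_discrete_form ?Dc m ?Qc
    by (rule ell2_discrete_form_induced[OF m b c DQ assms(4)])
  \<comment> \<open>Both index sets are determined by the dimension of the same space
    \<open>ell2 m\<close>.\<close>
  have J: "B.J = A.J"
    using A.eigenvalue_indices_eq B.eigenvalue_indices_eq by (simp add: inj_image_eq_iff)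
  have "associated_operator m ?Q0 DQ0 DL0 L0" using assms(3) by (simp add: realization_def)
  then have A_eigenvalue: "n \<in> A.J \<Longrightarrow> eigenvalue m DL0 L0 (Suc n) = A.lam n" for n
    by (rule A.eigenvalue_eq)
  have "associated_operator m ?Qc ?Dc DLc Lc"
    using assms(6) by (simp add: induced_realization_def induced_form_domain_eq[OF l2])
  then have B_eigenvalue: "n \<in> A.J \<Longrightarrow> eigenvalue m DLc Lc (Suc n) = B.lam n" for n
    unfolding J[symmetric] by (rule B.eigenvalue_eq)
  have Bev: "n \<in> A.J \<Longrightarrow> B.ev n \<in> ?Dc" for n using B.ev_in J by simp
  define d where "d n = B.lam n - A.lam n" for n
  define S where "S = ell1_sum_or_infinity (\<lambda>x. c x / m x)"
  have S: "S = (SUP G\<in>{G. finite G}. ereal (\<Sum>x\<in>G. c x / m x))"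
    unfolding S_def using c m by (intro ell1_sum_or_infinity_eq_SUP) (simp add: less_imp_le)
  \<comment> \<open>Ky Fan's inequality controls only partial sums; termwise non-negativity, which
    makes the unordered sum a supremum, comes from Courant-Fischer with the eigenvectors of
    \<open>Lc\<close> as test vectors.\<close>
  have d_nonneg: "0 \<le> d n" if n: "n \<in> A.J" for n
  proof -
    have nJ: "i \<le> n \<Longrightarrow> i \<in> A.J" for i using A.J_downward[OF n] by blast
    have "A.lam n \<le> B.lam n"
    proof (rule A.courant_fischer_upper_bound[OF n])
      show "B.ev i \<in> DQ0" if "i \<le> n" for i using Bev nJ that by blast
      show "ell2_inner m (B.ev i) (B.ev j) = (if i = j then 1 else 0)" if "i \<le> n" "j \<le> n" for i j
        using B.ev_inner nJ that J by simp
      fix a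
      let ?w = "\<Sum>i\<le>n. fscale (a i) (B.ev i)"
      have "?Q0 ?w ?w \<le> ?Qc ?w ?w"
        using wform_nonneg[of c ?w] c by (simp add: energy_form_split[of b c])
      also have "\<dots> \<le> B.lam n * (\<Sum>i\<le>n. (a i)\<^sup>2)"
        using B.Q_combination_le n J by simp
      finally show "?Q0 ?w ?w \<le> B.lam n * (\<Sum>i\<le>n. (a i)\<^sup>2)" .
    qed
    then show ?thesis by (simp add: d_def)
  qed
  have upper: "ereal (\<Sum>n<N. d n) \<le> S" if N: "{..<N} \<subseteq> A.J" for N
  proof (cases "(\<lambda>x. c x / m x) summable_on UNIV")
    case False
    then have "S = \<infinity>" using c m by (simp add: S_def ell1_sum_or_infinity_def less_imp_le)
    then show ?thesis by simp
  next
    case True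
    then have SS: "S = ereal (\<Sum>\<^sub>\<infinity>x. c x / m x)"
      using c m by (simp add: S_def ell1_sum_or_infinity_def less_imp_le)
    have sum_sq: "(\<Sum>n<N. c x * (A.ev n x)\<^sup>2) \<le> c x / m x" for x
      using mult_left_mono[OF A.sum_ev_square_le[OF N] c, of x x] by (simp add: sum_distrib_left)
    have bound: "(\<Sum>x\<in>G. \<Sum>n<N. c x * (A.ev n x)\<^sup>2) \<le> (\<Sum>\<^sub>\<infinity>x. c x / m x)" if "finite G" for G
    proof -
      have "(\<Sum>x\<in>G. \<Sum>n<N. c x * (A.ev n x)\<^sup>2) \<le> (\<Sum>x\<in>G. c x / m x)"
        by (intro sum_mono sum_sq)
      also have "\<dots> \<le> (\<Sum>\<^sub>\<infinity>x. c x / m x)"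
        using True that c m by (intro finite_sum_le_infsum) (auto simp: less_imp_le)
      finally show ?thesis .
    qed
    \<comment> \<open>Summability of \<open>c x / m x\<close> places the eigenvectors of
      \<open>L0\<close> in the domain of the induced form, so that they may be inserted into Ky
      Fan's inequality for it.\<close>
    have evc: "A.ev n \<in> wdom c" if n: "n < N" for n
    proof (rule wdomI_bounded(1)[OF c])
      fix G :: "'a set" assume "finite G"
      have "c x * (A.ev n x)\<^sup>2 \<le> (\<Sum>n<N. c x * (A.ev n x)\<^sup>2)" for x
        using n c by (intro member_le_sum) auto
      then have "(\<Sum>x\<in>G. c x * (A.ev n x)\<^sup>2) \<le> (\<Sum>x\<in>G. \<Sum>n<N. c x * (A.ev n x)\<^sup>2)"
        by (intro sum_mono)
      also note bound[OF \<open>finite G\<close>]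
      finally show "(\<Sum>x\<in>G. c x * (A.ev n x)\<^sup>2) \<le> (\<Sum>\<^sub>\<infinity>x. c x / m x)" .
    qed
    \<comment> \<open>The finite sum over \<open>n\<close> is moved inside the sum over
      \<open>X\<close>, where \<open>bound\<close> controls all finite partial sums.\<close>
    have "((\<lambda>x. \<Sum>n<N. c x * (A.ev n x)\<^sup>2) has_sum (\<Sum>n<N. wform c (A.ev n) (A.ev n))) UNIV"
    proof (rule has_sum_finite_sum)
      fix n assume "n \<in> {..<N}"
      then have "(\<lambda>x. c x * (A.ev n x)\<^sup>2) summable_on UNIV" using evc by (simp add: wdom_def)
      from has_sum_infsum[OF this]
      show "((\<lambda>x. c x * (A.ev n x)\<^sup>2) has_sum wform c (A.ev n) (A.ev n)) UNIV"
        by (simp add: wform_def power2_eq_square mult.assoc)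
    qed
    then have wform_le: "(\<Sum>n<N. wform c (A.ev n) (A.ev n)) \<le> (\<Sum>\<^sub>\<infinity>x. c x / m x)"
      using bound by (rule has_sum_le_finite_sums)
    have "(\<Sum>n<N. B.lam n) \<le> (\<Sum>n<N. ?Qc (A.ev n) (A.ev n))"
    proof (rule B.ky_fan_trace_inequality)
      show "{..<N} \<subseteq> B.J" using N J by simp
      show "A.ev i \<in> ?Dc" if "i < N" for i using evc A.ev_in N that by blast
      show "ell2_inner m (A.ev i) (A.ev j) = (if i = j then 1 else 0)" if "i < N" "j < N" for i j
        using A.ev_inner N that by (simp add: subset_iff)
    qed
    also have "\<dots> = (\<Sum>n<N. A.lam n) + (\<Sum>n<N. wform c (A.ev n) (A.ev n))"
      by (simp add: energy_form_split[of b c] A.lam_def sum.distrib)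
    finally show ?thesis using wform_le SS by (simp add: d_def sum_subtractf)
  qed
  \<comment> \<open>The eigenvectors of \<open>Lc\<close> have finite \<open>c\<close>-energy by
    construction, so this bound covers the summable and the divergent case at once.\<close>
  have lower: "\<exists>N. {..<N} \<subseteq> A.J \<and> z * (\<Sum>x\<in>G. c x / m x) \<le> (\<Sum>n<N. d n)"
    if G: "finite G" and z: "z < 1" for G z
  proof -
    obtain N where N: "{..<N} \<subseteq> A.J" and ge: "\<And>x. x \<in> G \<Longrightarrow> z / m x \<le> (\<Sum>n<N. (B.ev n x)\<^sup>2)"
      using B.sum_ev_square_ge[OF G z] J by auto
    have "z * (\<Sum>x\<in>G. c x / m x) = (\<Sum>x\<in>G. c x * (z / m x))"
      by (simp add: sum_distrib_left mult_ac)
    also have "\<dots> \<le> (\<Sum>x\<in>G. c x * (\<Sum>n<N. (B.ev n x)\<^sup>2))"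
      using ge c by (intro sum_mono mult_left_mono) auto
    also have "\<dots> = (\<Sum>n<N. \<Sum>x\<in>G. c x * (B.ev n x)\<^sup>2)"
      unfolding sum_distrib_left by (rule sum.swap)
    also have "\<dots> \<le> (\<Sum>n<N. wform c (B.ev n) (B.ev n))"
    proof (rule sum_mono)
      fix n assume "n \<in> {..<N}"
      then have "B.ev n \<in> wdom c" using Bev N by blast
      then show "(\<Sum>x\<in>G. c x * (B.ev n x)\<^sup>2) \<le> wform c (B.ev n) (B.ev n)"
        using wform_ge_sum[of c "B.ev n" G] c G by simp
    qed
    finally have 1: "z * (\<Sum>x\<in>G. c x / m x) \<le> (\<Sum>n<N. wform c (B.ev n) (B.ev n))" .
    have "(\<Sum>n<N. A.lam n) \<le> (\<Sum>n<N. ?Q0 (B.ev n) (B.ev n))"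
    proof (rule A.ky_fan_trace_inequality[OF N])
      show "B.ev i \<in> DQ0" if "i < N" for i using Bev N that by blast
      show "ell2_inner m (B.ev i) (B.ev j) = (if i = j then 1 else 0)" if "i < N" "j < N" for i j
        using B.ev_inner N that J by (simp add: subset_iff)
    qed
    also have "\<dots> = (\<Sum>n<N. B.lam n) - (\<Sum>n<N. wform c (B.ev n) (B.ev n))"
      by (simp add: energy_form_split[of b c] B.lam_def sum.distrib)
    finally show ?thesis using 1 N by (intro exI[of _ N]) (simp add: d_def sum_subtractf)
  qed
  have "((\<lambda>n. ereal (d n)) has_sum (SUP F\<in>{F. finite F \<and> F \<subseteq> A.J}. \<Sum>n\<in>F. ereal (d n))) A.J"
    (is "(_ has_sum ?sup) _")
    using d_nonneg by (intro nonneg_has_sum_complete) auto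
  also have "?sup = S"
  proof (rule antisym)
    show "?sup \<le> S"
    proof (rule SUP_least)
      fix F assume "F \<in> {F. finite F \<and> F \<subseteq> A.J}"
      then have F: "finite F" "F \<subseteq> A.J" by auto
      \<comment> \<open>Partial sums over arbitrary finite sets are enlarged to initial segments, on
        which \<open>upper\<close> is available.\<close>
      then obtain N where N: "{..<N} \<subseteq> A.J" "F \<subseteq> {..<N}" by (rule A.J_bounded)
      have "(\<Sum>n\<in>F. d n) \<le> (\<Sum>n<N. d n)" using N d_nonneg by (intro sum_mono2) auto
      then have "(\<Sum>n\<in>F. ereal (d n)) \<le> ereal (\<Sum>n<N. d n)" by simp
      also note upper[OF N(1)]
      finally show "(\<Sum>n\<in>F. ereal (d n)) \<le> S" .
    qed
    show "S \<le> ?sup"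
      unfolding S
    proof (rule SUP_least)
      fix G :: "'a set" assume "G \<in> {G. finite G}"
      then have G: "finite G" by simp
      let ?C = "\<Sum>x\<in>G. c x / m x"
      have le: "ereal (z * ?C) \<le> ?sup" if "z < 1" for z
      proof -
        obtain N where N: "{..<N} \<subseteq> A.J" "z * ?C \<le> (\<Sum>n<N. d n)" using lower[OF G \<open>z < 1\<close>] by blast
        then have "ereal (z * ?C) \<le> (\<Sum>n<N. ereal (d n))" by simp
        also have "\<dots> \<le> ?sup" using N by (intro SUP_upper) auto
        finally show ?thesis .
      qed
      then show "ereal ?C \<le> ?sup" by (rule ereal_le_mult_one_interval)
    qed
  qed
  finally have "((\<lambda>n. ereal (d n)) has_sum S) A.J" .
  also have "?this \<longleftrightarrow>
      (((\<lambda>n. ereal (eigenvalue m DLc Lc n - eigenvalue m DL0 L0 n)) \<circ> Suc) has_sum S) A.J"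
    by (rule has_sum_cong) (simp add: d_def A_eigenvalue B_eigenvalue)
  also have "\<dots> \<longleftrightarrow>
      ((\<lambda>n. ereal (eigenvalue m DLc Lc n - eigenvalue m DL0 L0 n)) has_sum S) (Suc ` A.J)"
    by (rule has_sum_reindex[symmetric]) simp
  finally show "((\<lambda>n. ereal (eigenvalue m DLc Lc n - eigenvalue m DL0 L0 n))
      has_sum ell1_sum_or_infinity (\<lambda>x. c x / m x)) (eigenvalue_indices m)"
    unfolding A.eigenvalue_indices_eq S_def .
  show "finite (eigenvalue_indices m) \<longleftrightarrow> finite (UNIV :: 'a set)"
    unfolding A.eigenvalue_indices_eq A.finite_J_iff[symmetric] by (simp add: finite_image_iff)
qed

end
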